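(* Let $t, n$ be integers with $1 < t < n$, let $Y$ be a $t \times n$ matrix of indeterminates, and let $\{\Delta\}$ denote the set of size $t$ minors of $Y$. Let $\pi \colon \mathbb{Q}[Y] \to \mathbb{Q}[\{\Delta\}]$ be any $\mathbb{Q}[\{\Delta\}]$-linear splitting of the inclusion $\mathbb{Q}[\{\Delta\}] \hookrightarrow \mathbb{Q}[Y]$. Then for every prime $p > 0$ there exists a monomial $\mu \in \mathbb{Q}[Y]$ such that in every expression of $\pi(\mu)$ as a polynomial in the elements of $\{\Delta\}$ with rational coefficients, at least one coefficient (in lowest terms) has denominator divisible by $p$; that is, $\pi(\mu) \notin \mathbb{Z}_{(p)}[\{\Delta\}]$.
   Context: $\mathbb{Q}[\{\Delta\}]$ is the $\mathbb{Q}$-subalgebra of $\mathbb{Q}[Y]$ generated by the size $t$ minors of $Y$, and $\mathbb{Z}_{(p)}[\{\Delta\}]$ is the $\mathbb{Z}_{(p)}$-subalgebra generated by them, where $\mathbb{Z}_{(p)} = \{a/b \in \mathbb{Q} : a, b \in \mathbb{Z},\ p \nmid b\}$. A $\mathbb{Q}[\{\Delta\}]$-linear splitting is a $\mathbb{Q}[\{\Delta\}]$-module homomorphism $\pi$ with $\pi(r) = r$ for all $r \in \mathbb{Q}[\{\Delta\}]$. A monomial is a product of nonnegative powers of the variables (with coefficient $1$). *)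

theory Defs
  imports
    "HOL-Library.Poly_Mapping"
    "HOL-Computational_Algebra.Primes"
    "Jordan_Normal_Form.Determinant"
    "Jordan_Normal_Form.DL_Submatrix"
begin

text \<open>
  A polynomial is a finitely supported map from monomials (exponent vectors) to coefficients.
  The indeterminates range over a whole type; the polynomial ring in a set of
  indeterminates is the subring \<open>polynomials\<close> below.
\<close>

type_synonym ('v, 'a) mpoly = "('v \<Rightarrow>\<^sub>0 nat) \<Rightarrow>\<^sub>0 'a"

definition Const :: "'a \<Rightarrow> ('v, 'a::zero) mpoly" where
  "Const c = Poly_Mapping.single 0 c"

definition Var :: "'v \<Rightarrow> ('v, 'a::zero_neq_one) mpoly" where
  "Var x = Poly_Mapping.single (Poly_Mapping.single x 1) 1"

definition polynomials :: "'v set \<Rightarrow> ('v, 'a::zero) mpoly set" where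
  "polynomials V = {f. \<forall>m \<in> Poly_Mapping.keys f. Poly_Mapping.keys m \<subseteq> V}"

definition monomials :: "'v set \<Rightarrow> ('v, 'a::zero_neq_one) mpoly set" where
  "monomials V = {Poly_Mapping.single m 1 |m. Poly_Mapping.keys m \<subseteq> V}"

definition matrix_vars :: "nat \<Rightarrow> nat \<Rightarrow> (nat \<times> nat) set" where
  "matrix_vars t n = {..<t} \<times> {..<n}"

definition generic_matrix :: "nat \<Rightarrow> nat \<Rightarrow> (nat \<times> nat, 'a::zero_neq_one) mpoly mat" where
  "generic_matrix t n = mat t n Var"

text \<open>\<open>submatrix\<close> keeps the selected rows and columns in increasing order.\<close>

definition minors :: "nat \<Rightarrow> 'a::comm_ring_1 mat \<Rightarrow> 'a set" where
  "minors k A = {det (submatrix A I J) |I J.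
     I \<subseteq> {..<dim_row A} \<and> J \<subseteq> {..<dim_col A} \<and> card I = k \<and> card J = k}"

definition is_subalgebra :: "'a::comm_ring_1 set \<Rightarrow> ('v, 'a) mpoly set \<Rightarrow> bool" where
  "is_subalgebra R A \<longleftrightarrow>
     Const ` R \<subseteq> A \<and> (\<forall>f \<in> A. \<forall>g \<in> A. f + g \<in> A \<and> f * g \<in> A)"

text \<open>
  For a subring \<open>R\<close> of the coefficients: the \<open>R\<close>-subalgebra generated by \<open>S\<close>.
  Closure under negation is automatic, since \<open>-1 \<in> R\<close>.
\<close>

definition generated_algebra ::
    "'a::comm_ring_1 set \<Rightarrow> ('v, 'a) mpoly set \<Rightarrow> ('v, 'a) mpoly set" where
  "generated_algebra R S = is_subalgebra R hull S"

definition localized_ints :: "nat \<Rightarrow> rat set" where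
  "localized_ints p = {of_int a / of_int b |a b. \<not> int p dvd b}"

definition denominator :: "rat \<Rightarrow> int" where
  "denominator c = snd (quotient_of c)"

definition is_linear_splitting :: "'a::comm_ring_1 set \<Rightarrow> 'a set \<Rightarrow> ('a \<Rightarrow> 'a) \<Rightarrow> bool" where
  "is_linear_splitting A B \<pi> \<longleftrightarrow>
     (\<forall>f \<in> B. \<pi> f \<in> A) \<and>
     (\<forall>f \<in> B. \<forall>g \<in> B. \<pi> (f + g) = \<pi> f + \<pi> g) \<and>
     (\<forall>r \<in> A. \<forall>f \<in> B. \<pi> (r * f) = r * \<pi> f) \<and>
     (\<forall>r \<in> A. \<pi> r = r)"

text \<open>
  A polynomial expression in elements of \<open>S\<close> is a polynomial \<open>F \<in> polynomials S\<close> whose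
  indeterminates are formal copies of those elements; \<open>evaluate F\<close> substitutes each element
  for its copy.
\<close>

definition evaluate :: "(('v, 'a) mpoly, 'a) mpoly \<Rightarrow> ('v, 'a::comm_ring_1) mpoly" where
  "evaluate F = (\<Sum>m \<in> Poly_Mapping.keys F. Const (Poly_Mapping.lookup F m) *
     (\<Prod>x \<in> Poly_Mapping.keys m. x ^ Poly_Mapping.lookup m x))"

end

(*
  If \<pi> sends all monomials into the subalgebra over the integers localized at p, then it may be
  applied to relations with integer coefficients. Let D 0, ..., D t be the maximal minors of the
  first t + 1 columns y 0, ..., y t. The key relation, valid in every commutative ring, is

    D 0 ^ (p-1) * D 1 ^ (p-1) * D 2  \<in>  (D 0 ^ p, ..., D t ^ p, p).

  Applying \<pi> puts the left side into the corresponding ideal of the subalgebra, in which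
  D 0, D 1, D 2 behave like independent variables; this is absurd.

  Proof of the relation: B u v = det [u, v, y 3, ..., y t] is an alternating form, and
  W u = B u (y 2). Over the fraction field, B u v = W' u * W v - W' v * W u for a second linear
  form W', and W' * W ^ (p-1) is additive modulo p up to a symmetric 2-cocycle which is a
  polynomial in B and W, hence defined integrally. Normalising by its vanishing on multiples of
  the axis vectors gives an integral primitive E of the cocycle with E (c u) = c ^ p E u. Cramer's
  relation \<Sum>j. d j y j = 0, with d j = (-1) ^ j D j, then yields modulo p

    0 = E (\<Sum>j. d j y j) = (\<Sum>j. d j ^ p E (y j)) + cocycle terms,

  and the only nonzero cocycle term is +- D 0 ^ (p-1) * D 1 ^ (p-1) * D 2.
*)
theory Submission
  imports Defs "HOL-Library.Function_Algebras"
begin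

section \<open>Divided differences of powers\<close>

text \<open>\<open>div_diff2 n u v\<close> and \<open>div_diff3 n u v w\<close> are the divided differences of \<open>x ^ n\<close> at the
  given points.\<close>

primrec div_diff2 :: "nat \<Rightarrow> 'a::comm_ring_1 \<Rightarrow> 'a \<Rightarrow> 'a" where
  "div_diff2 0 u v = 0"
| "div_diff2 (Suc n) u v = v * div_diff2 n u v + u ^ n"

primrec div_diff3 :: "nat \<Rightarrow> 'a::comm_ring_1 \<Rightarrow> 'a \<Rightarrow> 'a \<Rightarrow> 'a" where
  "div_diff3 0 u v w = 0"
| "div_diff3 (Suc n) u v w = w * div_diff3 n u v w + div_diff2 n u v"

lemma div_diff2_mult: "(u - v) * div_diff2 n u v = u ^ n - v ^ n"
proof (induction n)
  case (Suc n)
  have "(u - v) * div_diff2 (Suc n) u v = v * ((u - v) * div_diff2 n u v) + (u - v) * u ^ n"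
    by (simp add: algebra_simps)
  then show ?case unfolding Suc by (simp add: algebra_simps)
qed simp

lemma div_diff2_commute: "div_diff2 n u v = div_diff2 n v u"
proof (induction n)
  case (Suc n)
  then show ?case using div_diff2_mult[of u v n] by (simp add: algebra_simps)
qed simp

lemma div_diff2_diff: "div_diff2 n u v - div_diff2 n u w = (v - w) * div_diff3 n u v w"
proof (induction n)
  case (Suc n)
  have "div_diff2 (Suc n) u v - div_diff2 (Suc n) u w
    = w * (div_diff2 n u v - div_diff2 n u w) + (v - w) * div_diff2 n u v"
    by (simp add: algebra_simps)
  then show ?case unfolding Suc by (simp add: algebra_simps)
qed simp

lemma div_diff3_swap12: "div_diff3 n u v w = div_diff3 n v u w"
  by (induction n) (auto simp: div_diff2_commute)

lemma div_diff3_swap23: "div_diff3 n u v w = div_diff3 n u w v"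
proof (induction n)
  case (Suc n)
  then show ?case using div_diff2_diff[of n u v w] by (simp add: algebra_simps)
qed simp

lemma div_diff2_scale: "c * div_diff2 n (c * u) (c * v) = c ^ n * div_diff2 n u v"
proof (induction n)
  case (Suc n)
  have "c * div_diff2 (Suc n) (c * u) (c * v)
      = c * v * (c * div_diff2 n (c * u) (c * v)) + c * (c * u) ^ n"
    by (simp add: algebra_simps)
  then show ?case unfolding Suc by (simp add: algebra_simps power_mult_distrib)
qed simp

lemma div_diff2_minus: "div_diff2 n (- u) (- v) = - ((- 1) ^ n) * div_diff2 n u v"
proof -
  have "- div_diff2 n (- u) (- v) = (- 1) ^ n * div_diff2 n u v"
    using div_diff2_scale[of "-1" n u v] by simp
  then show ?thesis by (metis minus_minus mult_minus_left)
qed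

lemma div_diff3_minus: "div_diff3 n (- u) (- v) (- w) = (- 1) ^ n * div_diff3 n u v w"
  by (induction n) (auto simp: div_diff2_minus algebra_simps)

lemma div_diff2_zero_right: "div_diff2 (Suc n) u 0 = u ^ n"
  by simp

text \<open>Pascal's rule for an arbitrary sequence \<open>f\<close>; it serves the inductions for
  both translation formulas.\<close>

lemma binomial_sum_Suc:
  fixes f :: "nat \<Rightarrow> 'a::comm_ring_1"
  shows "(\<Sum>k\<le>Suc n. of_nat (Suc n choose k) * z ^ (Suc n - k) * f k) =
    (\<Sum>k\<le>n. of_nat (n choose k) * z ^ (n - k) * f (Suc k)) +
    z * (\<Sum>k\<le>n. of_nat (n choose k) * z ^ (n - k) * f k)"
proof -
  have "(\<Sum>k\<le>Suc n. of_nat (Suc n choose k) * z ^ (Suc n - k) * f k) =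
      z ^ Suc n * f 0 + (\<Sum>k\<le>n. of_nat (Suc n choose Suc k) * z ^ (n - k) * f (Suc k))"
    by (subst sum.atMost_Suc_shift) simp
  also have "(\<Sum>k\<le>n. of_nat (Suc n choose Suc k) * z ^ (n - k) * f (Suc k)) =
      (\<Sum>k\<le>n. of_nat (n choose k) * z ^ (n - k) * f (Suc k)) +
      (\<Sum>k\<le>n. of_nat (n choose Suc k) * z ^ (n - k) * f (Suc k))"
    by (simp add: algebra_simps sum.distrib)
  also have "z ^ Suc n * f 0 + (A + (\<Sum>k\<le>n. of_nat (n choose Suc k) * z ^ (n - k) * f (Suc k)))
      = A + (\<Sum>k\<le>Suc n. of_nat (n choose k) * z ^ (Suc n - k) * f k)" for A
    by (subst sum.atMost_Suc_shift) (simp add: algebra_simps)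
  also have "(\<Sum>k\<le>Suc n. of_nat (n choose k) * z ^ (Suc n - k) * f k)
      = z * (\<Sum>k\<le>n. of_nat (n choose k) * z ^ (n - k) * f k)"
    by (simp add: sum_distrib_left Suc_diff_le mult_ac binomial_eq_0)
  finally show ?thesis by simp
qed

text \<open>Divided differences are linear in the function, so this is the binomial expansion of (x
  + z)^n taken termwise.\<close>

lemma div_diff2_translate:
  "div_diff2 n (u + z) (v + z) = (\<Sum>k\<le>n. of_nat (n choose k) * z ^ (n - k) * div_diff2 k u v)"
proof (induction n)
  case (Suc n)
  show ?case unfolding binomial_sum_Suc div_diff2.simps Suc
    using binomial_ring[of u z n]
    by (simp add: algebra_simps sum.distrib sum_distrib_left)
qed simp

lemma div_diff3_translate:
  "div_diff3 n (u + z) (v + z) (w + z) =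
    (\<Sum>k\<le>n. of_nat (n choose k) * z ^ (n - k) * div_diff3 k u v w)"
proof (induction n)
  case (Suc n)
  show ?case unfolding binomial_sum_Suc div_diff3.simps Suc
    by (simp add: div_diff2_translate algebra_simps sum.distrib sum_distrib_left)
qed simp

text \<open>Modulo p, (x + z)^p is x^p + z^p, and divided differences ignore the constant z^p. Both
  congruences for the cocycle come from this invariance under translation.\<close>

lemma div_diff3_translate_dvd:
  fixes u v w z :: "'a::comm_ring_1"
  assumes "prime p"
  shows "of_nat p dvd div_diff3 p (u + z) (v + z) (w + z) - div_diff3 p u v w"
proof -
  have p: "p = Suc (p - 1)" using prime_gt_0_nat[OF assms] by simp
  let ?g = "\<lambda>k. of_nat (p choose k) * z ^ (p - k) * div_diff3 k u v w"
  have "sum ?g {..p} = sum ?g {..<p} + ?g p"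
    unfolding lessThan_Suc_atMost[symmetric] by (rule sum.lessThan_Suc)
  then have "div_diff3 p (u + z) (v + z) (w + z) - div_diff3 p u v w = sum ?g {..<p}"
    unfolding div_diff3_translate by simp
  moreover have "of_nat p dvd ?g k" if "k < p" for k
  \<comment> \<open>The binomial coefficient for k = 0 is 1, but there the divided difference of a
    constant is zero.\<close>
  proof (cases "k = 0")
    case False
    then have "p dvd p choose k" using that assms by (intro dvd_choose_prime) auto
    then show ?thesis by (auto simp: dvd_def mult.assoc)
  qed simp
  moreover have "of_nat p dvd sum ?g {..<p}"
    by (rule dvd_sum) (simp only: lessThan_iff calculation(2))
  ultimately show ?thesis by simp
qed


section \<open>The cocycle of a form satisfying the Pluecker relation\<close>

definition truncate_vec :: "nat \<Rightarrow> (nat \<Rightarrow> 'a::zero) \<Rightarrow> nat \<Rightarrow> 'a" where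
  "truncate_vec m u = (\<lambda>k. if k < m then u k else 0)"

definition axis_vec :: "nat \<Rightarrow> 'a::zero \<Rightarrow> nat \<Rightarrow> 'a" where
  "axis_vec m a = (\<lambda>k. if k = m then a else 0)"

lemma truncate_vec_0: "truncate_vec 0 u = 0"
  by (auto simp: truncate_vec_def)

lemma truncate_vec_add: "truncate_vec m (u + v) = truncate_vec m u + truncate_vec m v"
  for u v :: "nat \<Rightarrow> 'a::monoid_add"
  by (auto simp: truncate_vec_def)

lemma truncate_vec_Suc: "truncate_vec (Suc m) u = truncate_vec m u + axis_vec m (u m)"
  for u :: "nat \<Rightarrow> 'a::monoid_add"
  by (auto simp: truncate_vec_def axis_vec_def fun_eq_iff less_Suc_eq)

lemma axis_vec_add: "axis_vec m (a + b) = axis_vec m a + axis_vec m b"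
  for a b :: "'a::monoid_add"
  by (auto simp: axis_vec_def)

locale plucker_form =
  fixes p t :: nat
    and B :: "(nat \<Rightarrow> 'a::comm_ring_1) \<Rightarrow> (nat \<Rightarrow> 'a) \<Rightarrow> 'a"
    and W :: "(nat \<Rightarrow> 'a) \<Rightarrow> 'a"
  assumes p: "prime p"
    and B_add_left: "B (u + v) w = B u w + B v w"
    and B_scale_left: "B (\<lambda>k. c * u k) w = c * B u w"
    and B_self: "B u u = 0"
    and B_swap: "B v u = - B u v"
    and B_truncate_left: "B (truncate_vec t u) w = B u w"
    and W_add: "W (u + v) = W u + W v"
    and W_scale: "W (\<lambda>k. c * u k) = c * W u"
    and W_truncate: "W (truncate_vec t u) = W u"
    and plucker: "B v w * W u + B w u * W v + B u v * W w = 0"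
begin

lemma B_add_right: "B w (u + v) = B w u + B w v"
  unfolding B_swap[of w] B_add_left by simp

lemma B_scale_right: "B w (\<lambda>k. c * u k) = c * B w u"
  unfolding B_swap[of w] B_scale_left by simp

lemma B_truncate_right: "B w (truncate_vec t u) = B w u"
  unfolding B_swap[of w] B_truncate_left ..

lemma B_zero: "B 0 u = 0" "B u 0 = 0"
  using B_add_left[of 0 0 u] B_add_right[of u 0 0] by simp_all

lemma B_axis: "B (axis_vec m a) (axis_vec m b) = 0"
proof -
  have "axis_vec m a = (\<lambda>k. a * axis_vec m 1 k)" "axis_vec m b = (\<lambda>k. b * axis_vec m 1 k)"
    by (auto simp: axis_vec_def)
  then have "B (axis_vec m a) (axis_vec m b)
      = B (\<lambda>k. a * axis_vec m 1 k) (\<lambda>k. b * axis_vec m 1 k)"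
    by simp
  also have "\<dots> = 0" unfolding B_scale_left B_scale_right B_self by simp
  finally show ?thesis .
qed

text \<open>If B u v = W' u * W v - W' v * W u, this is modulo p the failure of additivity of W' *
  W^(p-1) at u, v. The formula itself no longer mentions W'.\<close>

definition cocycle :: "(nat \<Rightarrow> 'a) \<Rightarrow> (nat \<Rightarrow> 'a) \<Rightarrow> 'a" where
  "cocycle u v = B u v * div_diff2 (p - 1) (W u) (W u + W v)"

lemma p_Suc: "p = Suc (p - 1)"
  using prime_gt_0_nat[OF p] by simp

lemma div_diff3_p: "div_diff3 p u v w = w * div_diff3 (p - 1) u v w + div_diff2 (p - 1) u v"
  by (subst p_Suc) (simp only: div_diff3.simps)

text \<open>Grouping by the three values of B turns the coefficients into differences of divided
  differences. The common factor \<open>l\<close> then multiplies exactly the Pluecker relation, up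
  to a multiple of p.\<close>

lemma cocycle_identity:
  "of_nat p dvd cocycle u v + cocycle (u + v) w - cocycle v w - cocycle u (v + w)"
proof -
  define x y z s where "x = W u" and "y = W v" and "z = W w" and "s = x + y + z"
  define l where "l = div_diff3 (p - 1) x (x + y) s"
  let ?H = "div_diff2 (p - 1)"
  have 1: "?H x (x + y) - ?H x s = - z * l"
    using div_diff2_diff[of "p - 1" x "x + y" s] by (simp add: l_def s_def)
  have "?H s x - ?H s (x + y) = (x - (x + y)) * div_diff3 (p - 1) s x (x + y)"
    by (rule div_diff2_diff)
  also have "div_diff3 (p - 1) s x (x + y) = l"
    unfolding l_def by (metis div_diff3_swap12 div_diff3_swap23)
  finally have 2: "?H x s - ?H (x + y) s = - y * l"
    by (simp add: div_diff2_commute[of _ s])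
  \<comment> \<open>Translating the points y, y + z, 0 by x gives x + y, s, x. The point 0 reduces
    the original value to \<open>div_diff2\<close>.\<close>
  have "of_nat p dvd div_diff3 p (y + x) (y + z + x) (0 + x) - div_diff3 p y (y + z) 0"
    by (rule div_diff3_translate_dvd[OF p])
  moreover have "div_diff3 p (y + x) (y + z + x) (0 + x) = x * l + ?H (x + y) s"
    unfolding div_diff3_p l_def s_def
    by (simp add: add_ac) (metis div_diff3_swap12 div_diff3_swap23)
  ultimately have 3: "of_nat p dvd x * l + ?H (x + y) s - ?H y (y + z)"
    by (simp add: div_diff3_p)
  have pl: "B v w * x + B w u * y + B u v * z = 0"
    unfolding x_def y_def z_def by (rule plucker)
  have "cocycle u v + cocycle (u + v) w - cocycle v w - cocycle u (v + w)
      = B u v * (?H x (x + y) - ?H x s) + B w u * (?H x s - ?H (x + y) s)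
        + B v w * (?H (x + y) s - ?H y (y + z))"
    unfolding cocycle_def W_add x_def[symmetric] y_def[symmetric] z_def[symmetric]
      B_add_left B_add_right B_swap[of w u]
    by (simp add: s_def algebra_simps)
  also have "\<dots> = B v w * (x * l + ?H (x + y) s - ?H y (y + z))
      - l * (B v w * x + B w u * y + B u v * z)"
    unfolding 1 2 by (simp add: algebra_simps)
  finally show ?thesis using 3 unfolding pl by simp
qed

lemma cocycle_commute: "of_nat p dvd cocycle u v - cocycle v u"
proof -
  define x y s where "x = W u" and "y = W v" and "s = x + y"
  let ?H = "div_diff2 (p - 1)"
  \<comment> \<open>Translation by s takes -y, 0, -s to x, s, 0; both triples are, up to sign, of
    the form where one point is 0.\<close>
  have "of_nat p dvd div_diff3 p (- y + s) (0 + s) (- s + s) - div_diff3 p (- y) 0 (- s)"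
    by (rule div_diff3_translate_dvd[OF p])
  moreover have "div_diff3 p (- y + s) (0 + s) (- s + s) = ?H x s"
    by (simp add: div_diff3_p s_def)
  moreover have "div_diff3 p (- y) 0 (- s) = (- 1) ^ p * ?H y s"
    using div_diff3_minus[of p y 0 s] unfolding div_diff3_swap23[of p y 0 s] by (simp add: div_diff3_p)
  ultimately have 1: "of_nat p dvd ?H x s - (- 1) ^ p * ?H y s"
    by simp
  \<comment> \<open>For p = 2 the sum is p itself, for odd p it is zero; so -1 and (-1)^p may be
    exchanged.\<close>
  have 2: "of_nat p dvd (1 + (- 1) ^ p :: 'a)"
  proof (cases "p = 2")
    case False
    then have "odd p" using p prime_odd_nat prime_ge_2_nat[OF p] by force
    then show ?thesis by simp
  qed simp
  have "cocycle u v - cocycle v u = B u v * (?H x s + ?H y s)"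
    unfolding cocycle_def x_def[symmetric] y_def[symmetric] s_def B_swap[of v u]
    by (simp add: algebra_simps)
  also have "\<dots> = B u v * (?H x s - (- 1) ^ p * ?H y s) + B u v * ?H y s * (1 + (- 1) ^ p)"
    by (simp add: algebra_simps)
  finally show ?thesis using 1 2 by simp
qed

text \<open>For a coboundary, both groups of three terms measure the failure of additivity on S, T,
  u, v together. Only the cocycle identity and symmetry are used.\<close>

lemma cocycle_interchange:
  "of_nat p dvd cocycle S u + cocycle T v + cocycle (S + u) (T + v)
    - cocycle S T - cocycle u v - cocycle (S + T) (u + v)"
  (is "_ dvd ?X")
proof -
  have 1: "of_nat p dvd cocycle (S + u) T + cocycle (S + u + T) v - cocycle T v - cocycle (S + u) (T + v)"
    by (rule cocycle_identity)
  have 2: "of_nat p dvd cocycle u S + cocycle (u + S) T - cocycle S T - cocycle u (S + T)"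
    by (rule cocycle_identity)
  have 3: "of_nat p dvd cocycle (S + T) u + cocycle (S + T + u) v - cocycle u v - cocycle (S + T) (u + v)"
    by (rule cocycle_identity)
  have 4: "of_nat p dvd cocycle S u - cocycle u S" "of_nat p dvd cocycle u (S + T) - cocycle (S + T) u"
    by (rule cocycle_commute)+
  have "of_nat p dvd
      (cocycle S u - cocycle u S) + (cocycle u (S + T) - cocycle (S + T) u)
      + (cocycle u S + cocycle (u + S) T - cocycle S T - cocycle u (S + T))
      + (cocycle (S + T) u + cocycle (S + T + u) v - cocycle u v - cocycle (S + T) (u + v))
      - (cocycle (S + u) T + cocycle (S + u + T) v - cocycle T v - cocycle (S + u) (T + v))"
    by (intro dvd_add dvd_diff 1 2 3 4)
  also have "\<dots> = ?X"
    by (simp add: ac_simps)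
  finally show ?thesis .
qed

text \<open>Builds u up one coordinate at a time. A function that vanishes at multiples of the axis
  vectors and has \<open>cocycle\<close> as its failure of additivity must take this value on the
  first m coordinates.\<close>

definition primitive :: "nat \<Rightarrow> (nat \<Rightarrow> 'a) \<Rightarrow> 'a" where
  "primitive m u = (\<Sum>i<m. cocycle (truncate_vec i u) (axis_vec i (u i)))"

lemma cocycle_zero: "cocycle 0 u = 0" "cocycle u 0 = 0"
  by (simp_all add: cocycle_def B_zero)

text \<open>The terms added by coordinate m are compared by \<open>cocycle_interchange\<close>,
  where the cocycle of the two axis vectors is zero because B is alternating.\<close>

lemma primitive_add_truncate: "of_nat p dvd primitive m (u + v) - primitive m u - primitive m v
    - cocycle (truncate_vec m u) (truncate_vec m v)"
proof (induction m)
  case 0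
  show ?case unfolding primitive_def truncate_vec_0 cocycle_zero by simp
next
  case (Suc m)
  let ?S = "truncate_vec m u" and ?T = "truncate_vec m v"
  let ?u = "axis_vec m (u m)" and ?v = "axis_vec m (v m)"
  have P: "primitive (Suc m) w = primitive m w + cocycle (truncate_vec m w) (axis_vec m (w m))" for w
    by (simp add: primitive_def)
  have 0: "cocycle ?u ?v = 0" by (simp add: cocycle_def B_axis)
  have "primitive (Suc m) (u + v) - primitive (Suc m) u - primitive (Suc m) v
      - cocycle (truncate_vec (Suc m) u) (truncate_vec (Suc m) v)
    = (primitive m (u + v) - primitive m u - primitive m v - cocycle ?S ?T)
      - (cocycle ?S ?u + cocycle ?T ?v + cocycle (?S + ?u) (?T + ?v)
        - cocycle ?S ?T - cocycle ?u ?v - cocycle (?S + ?T) (?u + ?v))"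
    unfolding P truncate_vec_Suc truncate_vec_add plus_fun_apply axis_vec_add 0
    by (simp add: algebra_simps)
  also have "of_nat p dvd \<dots>"
    by (intro dvd_diff Suc cocycle_interchange)
  finally show ?case .
qed

lemma primitive_add:
  "of_nat p dvd primitive t (u + v) - primitive t u - primitive t v - cocycle u v"
  using primitive_add_truncate[of t u v]
  by (simp add: cocycle_def B_truncate_left B_truncate_right W_truncate)

text \<open>B contributes two factors c and the divided difference, of degree p - 2, the others. The
  equality is exact and makes the p-th powers of minors appear later.\<close>

lemma cocycle_scale: "cocycle (\<lambda>k. c * u k) (\<lambda>k. c * v k) = c ^ p * cocycle u v"
proof -
  have "cocycle (\<lambda>k. c * u k) (\<lambda>k. c * v k)
      = c * B u v * (c * div_diff2 (p - 1) (c * W u) (c * (W u + W v)))"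
    by (simp add: cocycle_def B_scale_left B_scale_right W_scale algebra_simps)
  also have "\<dots> = (c * c ^ (p - 1)) * cocycle u v"
    unfolding div_diff2_scale cocycle_def by (simp add: algebra_simps)
  also have "c * c ^ (p - 1) = c ^ p"
    unfolding power_Suc[symmetric] p_Suc[symmetric] ..
  finally show ?thesis .
qed

lemma primitive_scale: "primitive m (\<lambda>k. c * u k) = c ^ p * primitive m u"
proof -
  have "truncate_vec i (\<lambda>k. c * u k) = (\<lambda>k. c * truncate_vec i u k)"
    "axis_vec i (c * u i) = (\<lambda>k. c * axis_vec i (u i) k)" for i
    by (auto simp: truncate_vec_def axis_vec_def)
  then show ?thesis by (simp add: primitive_def cocycle_scale sum_distrib_left)
qed

lemma primitive_zero: "primitive m 0 = 0"
proof -
  have "truncate_vec i (0 :: nat \<Rightarrow> 'a) = 0" for i by (auto simp: truncate_vec_def)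
  then show ?thesis by (simp add: primitive_def cocycle_zero)
qed

lemma primitive_sum:
  fixes N :: nat
  shows "of_nat p dvd primitive t (\<Sum>j<N. V j) - (\<Sum>j<N. primitive t (V j))
    - (\<Sum>j<N. cocycle (\<Sum>i<j. V i) (V j))"
proof (induction N)
  case (Suc N)
  have eq: "a - (b + c) - (e + f) = (g - b - e) + (a - g - c - f)" for a b c e f g :: 'a
    by simp
  show ?case
    unfolding sum.lessThan_Suc eq[where g = "primitive t (\<Sum>j<N. V j)"]
    by (intro dvd_add Suc primitive_add)
next
  case 0
  show ?case unfolding lessThan_0 sum.empty primitive_zero by simp
qed

text \<open>Evaluates the primitive at the zero vector, written as the sum of the d j y j, one
  summand at a time.\<close>

lemma minor_power_combination:
  fixes y :: "nat \<Rightarrow> nat \<Rightarrow> 'a" and d :: "nat \<Rightarrow> 'a"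
  assumes N: "3 \<le> N"
    and W: "\<And>u. W u = B u (y 2)"
    and ker: "\<And>u j. 3 \<le> j \<Longrightarrow> j < N \<Longrightarrow> B u (y j) = 0"
    and d: "d 0 = B (y 1) (y 2)" "d 1 = B (y 2) (y 0)" "d 2 = B (y 0) (y 1)"
    and rel: "\<And>k. (\<Sum>j<N. d j * y j k) = 0"
  shows "\<exists>f h. d 0 ^ (p - 1) * d 1 ^ (p - 1) * d 2 = (\<Sum>j<N. f j * d j ^ p) + of_nat p * h"
proof -
  define V where "V = (\<lambda>j k. d j * y j k)"
  have sumV: "(\<Sum>j<n. V j) k = (\<Sum>j<n. d j * y j k)" for n k
    by (induction n) (auto simp: V_def)
  have V0: "(\<Sum>j<N. V j) = 0"
    by (rule ext) (simp add: sumV rel)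
  have WV0: "W (V 0) = - (d 0 * d 1)"
    unfolding V_def W_scale W d(2) B_swap[of "y 0" "y 2"] by simp
  have WV1: "W (V 1) = d 0 * d 1"
    unfolding V_def W_scale W d(1) by (rule mult.commute)
  \<comment> \<open>Only j = 1 survives: the partial sum is empty at j = 0, the values of W at V 0
    and V 1 cancel at j = 2, and \<open>ker\<close> covers the later columns.\<close>
  have zero: "cocycle (\<Sum>i<j. V i) (V j) = 0" if j: "j < N" "j \<noteq> 1" for j
  proof -
    consider "j = 0" | "j = 2" | "3 \<le> j" using j by arith
    then have "B (\<Sum>i<j. V i) (V j) = 0"
    proof cases
      case 1
      then show ?thesis by (simp only: lessThan_0 sum.empty B_zero)
    next
      case 2
      have *: "V j = (\<lambda>k. d 2 * y 2 k)" unfolding V_def 2 ..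
      have "(\<Sum>i<j. V i) = V 0 + V 1" unfolding 2 by (simp add: numeral_2_eq_2)
      then have "B (\<Sum>i<j. V i) (V j) = d 2 * (W (V 0) + W (V 1))"
        unfolding * B_scale_right W[symmetric] by (simp only: W_add)
      then show ?thesis unfolding WV0 WV1 by simp
    next
      case 3
      then show ?thesis unfolding V_def B_scale_right using ker[OF 3 j(1)] by simp
    qed
    then show ?thesis by (simp add: cocycle_def)
  qed
  have "(\<Sum>j<N. cocycle (\<Sum>i<j. V i) (V j)) = (\<Sum>j\<in>{1}. cocycle (\<Sum>i<j. V i) (V j))"
    by (rule sum.mono_neutral_right) (use N zero in auto)
  also have "\<dots> = cocycle (V 0) (V 1)" by simp
  \<comment> \<open>Since W (V 0) + W (V 1) = 0, the second point is 0 and the divided difference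
    becomes a single power.\<close>
  also have "\<dots> = d 0 * d 1 * d 2 * div_diff2 (p - 1) (- (d 0 * d 1)) 0"
    unfolding cocycle_def WV0 WV1 unfolding V_def B_scale_left B_scale_right d(3)
    by (simp add: mult_ac)
  also have "p - 1 = Suc (p - 2)" using prime_ge_2_nat[OF p] by simp
  also have "div_diff2 (Suc (p - 2)) (- (d 0 * d 1)) 0 = (- 1) ^ (p - 2) * (d 0 * d 1) ^ (p - 2)"
    unfolding div_diff2_zero_right by (rule power_minus)
  finally have c: "(\<Sum>j<N. cocycle (\<Sum>i<j. V i) (V j)) =
      (- 1) ^ (p - 2) * (d 0 ^ (p - 1) * d 1 ^ (p - 1) * d 2)"
    unfolding \<open>p - 1 = Suc (p - 2)\<close> by (simp add: power_mult_distrib mult_ac)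
  have e: "primitive t (V j) = d j ^ p * primitive t (y j)" for j
    unfolding V_def by (rule primitive_scale)
  define s :: 'a where "s = (- 1) ^ (p - 2)"
  have s: "s * s = 1" by (simp add: s_def flip: power_mult_distrib)
  define r X where "r = d 0 ^ (p - 1) * d 1 ^ (p - 1) * d 2"
    and "X = (\<Sum>j<N. d j ^ p * primitive t (y j))"
  have "of_nat p dvd 0 - X - s * r"
    using primitive_sum[where V = V and N = N]
    unfolding V0 e c primitive_zero s_def[symmetric] r_def[symmetric] X_def[symmetric] .
  then obtain h where h: "0 - X - s * r = of_nat p * h" by (rule dvdE)
  have "r = s * s * r" unfolding s by simp
  also have "\<dots> = s * (- X - (0 - X - s * r))" by (simp add: algebra_simps)
  also have "\<dots> = (\<Sum>j<N. (- s * primitive t (y j)) * d j ^ p) + of_nat p * (- s * h)"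
    unfolding h by (simp add: X_def algebra_simps sum_distrib_left sum_negf)
  finally show ?thesis unfolding r_def
    by (intro exI[of _ "\<lambda>j. - s * primitive t (y j)"] exI[of _ "- s * h"])
qed

end

section \<open>Maximal minors of a matrix with one column more than rows\<close>

definition omit_det :: "nat \<Rightarrow> (nat \<Rightarrow> nat \<Rightarrow> 'a::comm_ring_1) \<Rightarrow> nat \<Rightarrow> 'a" where
  "omit_det t y j = det (mat t t (\<lambda>(k, c). y (if c < j then c else Suc c) k))"

text \<open>Putting a second copy of row k on top gives a square matrix with determinant zero, which
  is expanded along the new row.\<close>

lemma omit_det_relation:
  assumes k: "k < t"
  shows "(\<Sum>j<Suc t. (- 1) ^ j * omit_det t y j * y j k) = 0"
proof -
  define A where "A = mat (Suc t) (Suc t) (\<lambda>(i, j). if i = 0 then y j k else y j (i - 1))"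
  have A: "A \<in> carrier_mat (Suc t) (Suc t)" by (simp add: A_def)
  have "det A = 0"
  proof (rule det_identical_rows[OF A, of 0 "Suc k"])
    show "row A 0 = row A (Suc k)"
      by (rule eq_vecI) (use k in \<open>auto simp: A_def\<close>)
  qed (use k in auto)
  moreover have "det A = (\<Sum>j<Suc t. A $$ (0, j) * cofactor A 0 j)"
    by (rule laplace_expansion_row[OF A]) simp
  moreover have "A $$ (0, j) * cofactor A 0 j = (- 1) ^ j * omit_det t y j * y j k" if "j < Suc t" for j
  proof -
    have "mat_delete A 0 j = mat t t (\<lambda>(k, c). y (if c < j then c else Suc c) k)"
      by (rule eq_matI) (use that in \<open>auto simp: A_def mat_delete_def\<close>)
    then show ?thesis using that by (simp add: cofactor_def omit_det_def A_def)
  qed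
  ultimately show ?thesis by simp
qed

section \<open>The bracket det [u, v, y 3, ..., y t] and its three-term Pluecker relation\<close>

context
  fixes t :: nat and y :: "nat \<Rightarrow> nat \<Rightarrow> 'a::comm_ring_1"
  assumes t: "2 \<le> t"
begin

definition bracket_mat :: "(nat \<Rightarrow> 'a) \<Rightarrow> (nat \<Rightarrow> 'a) \<Rightarrow> 'a mat" where
  "bracket_mat u v = mat t t (\<lambda>(k, c). if c = 0 then u k else if c = 1 then v k else y (Suc c) k)"

definition bracket :: "(nat \<Rightarrow> 'a) \<Rightarrow> (nat \<Rightarrow> 'a) \<Rightarrow> 'a" where
  "bracket u v = det (bracket_mat u v)"

lemma bracket_mat_carrier: "bracket_mat u v \<in> carrier_mat t t"
  by (simp add: bracket_mat_def)

text \<open>The cofactors along column 0 do not see that column, so it may be replaced by 0 in them.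
  This makes linearity in u visible.\<close>

lemma bracket_expand: "bracket u v = (\<Sum>i<t. u i * cofactor (bracket_mat 0 v) i 0)"
proof -
  have "bracket u v = (\<Sum>i<t. bracket_mat u v $$ (i, 0) * cofactor (bracket_mat u v) i 0)"
    unfolding bracket_def by (rule laplace_expansion_column[OF bracket_mat_carrier]) (use t in simp)
  also have "\<dots> = (\<Sum>i<t. u i * cofactor (bracket_mat 0 v) i 0)"
  proof (rule sum.cong[OF refl])
    fix i assume "i \<in> {..<t}"
    moreover have "mat_delete (bracket_mat u v) i 0 = mat_delete (bracket_mat 0 v) i 0"
      by (rule eq_matI) (auto simp: mat_delete_def bracket_mat_def)
    ultimately show "bracket_mat u v $$ (i, 0) * cofactor (bracket_mat u v) i 0
        = u i * cofactor (bracket_mat 0 v) i 0"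
      using t by (simp add: cofactor_def) (simp add: bracket_mat_def)
  qed
  finally show ?thesis .
qed

lemma bracket_add_left: "bracket (u + v) w = bracket u w + bracket v w"
  unfolding bracket_expand[of _ w] by (simp add: algebra_simps sum.distrib)

lemma bracket_scale_left: "bracket (\<lambda>k. c * u k) w = c * bracket u w"
  unfolding bracket_expand[of _ w] by (simp add: sum_distrib_left mult.assoc)

lemma bracket_self: "bracket u u = 0"
  unfolding bracket_def
proof (rule det_identical_columns[OF bracket_mat_carrier, of 0 1])
  show "col (bracket_mat u u) 0 = col (bracket_mat u u) 1"
    by (rule eq_vecI) (use t in \<open>auto simp: bracket_mat_def\<close>)
qed (use t in auto)

lemma bracket_column: "3 \<le> j \<Longrightarrow> j < Suc t \<Longrightarrow> bracket u (y j) = 0"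
  unfolding bracket_def
proof (rule det_identical_columns[OF bracket_mat_carrier, of 1 "j - 1"])
  assume "3 \<le> j" "j < Suc t"
  then show "col (bracket_mat u (y j)) 1 = col (bracket_mat u (y j)) (j - 1)"
    by (intro eq_vecI) (auto simp: bracket_mat_def)
qed (use t in auto)

lemma bracket_swap: "bracket v u = - bracket u v"
proof -
  have "bracket_mat v u = swapcols 0 1 (bracket_mat u v)"
    by (rule eq_matI) (use t in \<open>auto simp: bracket_mat_def\<close>)
  then show ?thesis unfolding bracket_def
    using det_swapcols[OF _ _ _ bracket_mat_carrier, of 0 1 u v] t by simp
qed

lemma bracket_truncate_left: "bracket (truncate_vec t u) v = bracket u v"
proof -
  have "bracket_mat (truncate_vec t u) v = bracket_mat u v"
    by (rule eq_matI) (auto simp: bracket_mat_def truncate_vec_def)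
  then show ?thesis by (simp add: bracket_def)
qed

text \<open>The family \<open>z\<close> may differ from \<open>y\<close> in the first three columns,
  which lets the Pluecker relation insert arbitrary vectors there.\<close>

lemma omit_det_bracket:
  assumes "\<And>j k. 3 \<le> j \<Longrightarrow> j < Suc t \<Longrightarrow> k < t \<Longrightarrow> z j k = y j k"
  shows "omit_det t z 0 = bracket (z 1) (z 2)"
    and "omit_det t z 1 = bracket (z 0) (z 2)"
    and "omit_det t z 2 = bracket (z 0) (z 1)"
proof -
  have *: "c = 0 \<or> c = 1 \<or> 2 \<le> c" for c :: nat by arith
  have "mat t t (\<lambda>(k, c). z (if c < 0 then c else Suc c) k) = bracket_mat (z 1) (z 2)"
    by (rule eq_matI) (use assms * in \<open>auto simp: bracket_mat_def numeral_2_eq_2\<close>)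
  then show "omit_det t z 0 = bracket (z 1) (z 2)"
    by (simp add: omit_det_def bracket_def)
  have "mat t t (\<lambda>(k, c). z (if c < 1 then c else Suc c) k) = bracket_mat (z 0) (z 2)"
    by (rule eq_matI) (use assms * in \<open>auto simp: bracket_mat_def numeral_2_eq_2\<close>)
  then show "omit_det t z 1 = bracket (z 0) (z 2)"
    unfolding omit_det_def bracket_def by simp
  have "mat t t (\<lambda>(k, c). z (if c < 2 then c else Suc c) k) = bracket_mat (z 0) (z 1)"
    by (rule eq_matI) (use assms * in \<open>auto simp: bracket_mat_def numeral_2_eq_2\<close>)
  then show "omit_det t z 2 = bracket (z 0) (z 1)"
    by (simp add: omit_det_def bracket_def)
qed

text \<open>Apply the linear form \<open>bracket x (y 2)\<close> in x to Cramer's relation among u,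
  v, w, y 3, ..., y t. The terms from y 3 on have a repeated column, and the three remaining
  coefficients are brackets.\<close>

lemma bracket_plucker:
  "bracket v w * bracket u (y 2) + bracket w u * bracket v (y 2) + bracket u v * bracket w (y 2) = 0"
proof -
  define z where "z = (\<lambda>j. if j = 0 then u else if j = 1 then v else if j = 2 then w else y j)"
  define d where "d = (\<lambda>j. (- 1) ^ j * omit_det t z j)"
  define C where "C = (\<lambda>i. cofactor (bracket_mat 0 (y 2)) i 0)"
  have z: "z 0 = u" "z 1 = v" "z 2 = w" by (simp_all add: z_def)
  have dz: "d 0 = bracket v w" "d 1 = - bracket u w" "d 2 = bracket u v"
    using omit_det_bracket[of z] by (simp_all add: d_def z z_def)
  have W: "bracket x (y 2) = (\<Sum>i<t. x i * C i)" for x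
    unfolding C_def by (rule bracket_expand)
  have zero: "bracket (z j) (y 2) = 0" if "3 \<le> j" "j < Suc t" for j
    using bracket_column[OF that, of "y 2"] bracket_swap[of "z j" "y 2"] that by (simp add: z_def)
  have "0 = (\<Sum>i<t. (\<Sum>j<Suc t. d j * z j i) * C i)"
    by (rule sym, rule sum.neutral) (use omit_det_relation[where y = z] in \<open>simp add: d_def\<close>)
  also have "\<dots> = (\<Sum>j<Suc t. \<Sum>i<t. d j * z j i * C i)"
    unfolding sum_distrib_right by (rule sum.swap)
  also have "\<dots> = (\<Sum>j<Suc t. d j * bracket (z j) (y 2))"
    unfolding W by (simp add: sum_distrib_left mult.assoc)
  also have "\<dots> = (\<Sum>j<3. d j * bracket (z j) (y 2))"
    by (rule sum.mono_neutral_right) (use t zero in auto)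
  also have "\<dots> = d 0 * bracket u (y 2) + d 1 * bracket v (y 2) + d 2 * bracket w (y 2)"
    unfolding z[symmetric] by (simp add: numeral_3_eq_3 numeral_2_eq_2)
  finally show ?thesis unfolding dz bracket_swap[of w u] by simp
qed

end

theorem omit_det_power_combination:
  fixes y :: "nat \<Rightarrow> nat \<Rightarrow> 'a::comm_ring_1"
  assumes p: "prime p" and t: "2 \<le> t"
  shows "\<exists>f h. omit_det t y 0 ^ (p - 1) * omit_det t y 1 ^ (p - 1) * omit_det t y 2
    = (\<Sum>j<Suc t. f j * omit_det t y j ^ p) + of_nat p * h"
proof -
  \<comment> \<open>After truncation Cramer's relation holds at every index k, as \<open>rel\<close>
    demands, and not only for k < t.\<close>
  define z where "z = (\<lambda>j. truncate_vec t (y j))"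
  define d where "d = (\<lambda>j. (- 1) ^ j * omit_det t z j)"
  have zy: "omit_det t z j = omit_det t y j" for j
  proof -
    have "mat t t (\<lambda>(k, c). z (if c < j then c else Suc c) k)
        = mat t t (\<lambda>(k, c). y (if c < j then c else Suc c) k)"
      by (rule eq_matI) (auto simp: z_def truncate_vec_def)
    then show ?thesis by (simp add: omit_det_def)
  qed
  interpret plucker_form p t "bracket t z" "\<lambda>u. bracket t z u (z 2)"
    by unfold_locales
      (rule p bracket_add_left[OF t] bracket_scale_left[OF t] bracket_self[OF t]
         bracket_swap[OF t] bracket_truncate_left[OF t] bracket_plucker[OF t])+
  have "\<exists>f h. d 0 ^ (p - 1) * d 1 ^ (p - 1) * d 2 = (\<Sum>j<Suc t. f j * d j ^ p) + of_nat p * h"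
  proof (rule minor_power_combination[where y = z])
    show "bracket t z u (z j) = 0" if "3 \<le> j" "j < Suc t" for u j
      using that by (rule bracket_column[OF t])
    show "d 0 = bracket t z (z 1) (z 2)" "d 2 = bracket t z (z 0) (z 1)"
      using omit_det_bracket[OF t, of z z] by (simp_all add: d_def)
    show "d 1 = bracket t z (z 2) (z 0)"
      using omit_det_bracket[OF t, of z z] bracket_swap[OF t, of z "z 2" "z 0"] by (simp add: d_def)
    show "(\<Sum>j<Suc t. d j * z j k) = 0" for k
    proof (cases "k < t")
      case True
      then show ?thesis unfolding d_def by (rule omit_det_relation)
    qed (simp add: z_def truncate_vec_def)
  qed (use t in auto)
  then obtain f h where fh:
    "d 0 ^ (p - 1) * d 1 ^ (p - 1) * d 2 = (\<Sum>j<Suc t. f j * d j ^ p) + of_nat p * h"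
    by blast
  \<comment> \<open>Of the signs in d 0, d 1, d 2 only that of d 1 is negative; its (p-1)-st power
    is \<open>s\<close>.\<close>
  define s :: 'a where "s = (- 1) ^ (p - 1)"
  have s: "s * s = 1" by (simp add: s_def flip: power_mult_distrib)
  have "omit_det t y 0 ^ (p - 1) * omit_det t y 1 ^ (p - 1) * omit_det t y 2
      = s * (d 0 ^ (p - 1) * d 1 ^ (p - 1) * d 2)"
  proof -
    have "d 1 ^ (p - 1) = s * omit_det t y 1 ^ (p - 1)"
      unfolding d_def zy s_def by (simp flip: power_mult_distrib)
    then have "s * (d 0 ^ (p - 1) * d 1 ^ (p - 1) * d 2)
        = (s * s) * (d 0 ^ (p - 1) * omit_det t y 1 ^ (p - 1) * d 2)"
      by (simp only: mult_ac)
    then show ?thesis unfolding s by (simp add: d_def zy)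
  qed
  also have "\<dots> = (\<Sum>j<Suc t. (s * f j * ((- 1) ^ j) ^ p) * omit_det t y j ^ p) + of_nat p * (s * h)"
    unfolding fh unfolding d_def zy power_mult_distrib
    by (simp add: algebra_simps sum_distrib_left)
  finally show ?thesis
    by (intro exI[of _ "\<lambda>j. s * f j * ((- 1) ^ j) ^ p"] exI[of _ "s * h"])
qed

section \<open>Substitution, generated subalgebras and localized integers\<close>

definition monomial_value :: "('v \<Rightarrow> 'b::comm_ring_1) \<Rightarrow> ('v \<Rightarrow>\<^sub>0 nat) \<Rightarrow> 'b" where
  "monomial_value \<phi> m = (\<Prod>x \<in> Poly_Mapping.keys m. \<phi> x ^ Poly_Mapping.lookup m x)"

text \<open>Coefficients and variables are mapped separately, so one notion covers both the passage
  from integer to rational coefficients and the specialization into iterated univariate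
  polynomials.\<close>

definition substitute :: "('a::zero \<Rightarrow> 'b::comm_ring_1) \<Rightarrow> ('v \<Rightarrow> 'b) \<Rightarrow> ('v, 'a) mpoly \<Rightarrow> 'b" where
  "substitute \<iota> \<phi> f =
    (\<Sum>m \<in> Poly_Mapping.keys f. \<iota> (Poly_Mapping.lookup f m) * monomial_value \<phi> m)"

lemma monomial_value_superset:
  assumes "finite K" "Poly_Mapping.keys m \<subseteq> K"
  shows "monomial_value \<phi> m = (\<Prod>x\<in>K. \<phi> x ^ Poly_Mapping.lookup m x)"
  unfolding monomial_value_def
  by (rule prod.mono_neutral_left) (use assms in \<open>auto simp: in_keys_iff\<close>)

lemma monomial_value_add:
  "monomial_value \<phi> (a + b) = monomial_value \<phi> a * monomial_value \<phi> b"
proof -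
  let ?K = "Poly_Mapping.keys a \<union> Poly_Mapping.keys b"
  have *: "finite ?K" "Poly_Mapping.keys (a + b) \<subseteq> ?K" using keys_add[of a b] by auto
  show ?thesis
    unfolding monomial_value_superset[OF *] monomial_value_superset[OF *(1) Un_upper1]
      monomial_value_superset[OF *(1) Un_upper2]
    by (simp add: lookup_add power_add prod.distrib)
qed

lemma mpoly_eq_sum_single:
  "f = (\<Sum>m \<in> Poly_Mapping.keys f. Poly_Mapping.single m (Poly_Mapping.lookup f m))"
  for f :: "('v, 'a::comm_monoid_add) mpoly"
proof (rule poly_mapping_eqI)
  fix k
  have "(\<Sum>m \<in> Poly_Mapping.keys f. Poly_Mapping.lookup (Poly_Mapping.single m (Poly_Mapping.lookup f m)) k)
      = (\<Sum>m \<in> Poly_Mapping.keys f. if m = k then Poly_Mapping.lookup f m else 0)"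
    by (intro sum.cong) (auto simp: lookup_single when_def)
  also have "\<dots> = Poly_Mapping.lookup f k" by (simp add: in_keys_iff)
  finally show "Poly_Mapping.lookup f k = Poly_Mapping.lookup
      (\<Sum>m \<in> Poly_Mapping.keys f. Poly_Mapping.single m (Poly_Mapping.lookup f m)) k"
    by (simp add: lookup_sum)
qed

context comm_ring_hom
begin

lemma substitute_superset:
  assumes "finite K" "Poly_Mapping.keys f \<subseteq> K"
  shows "substitute hom \<phi> f = (\<Sum>m\<in>K. hom (Poly_Mapping.lookup f m) * monomial_value \<phi> m)"
  unfolding substitute_def
  by (rule sum.mono_neutral_left) (use assms in \<open>auto simp: in_keys_iff\<close>)

lemma substitute_add: "substitute hom \<phi> (f + g) = substitute hom \<phi> f + substitute hom \<phi> g"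
proof -
  let ?K = "Poly_Mapping.keys f \<union> Poly_Mapping.keys g"
  have *: "finite ?K" "Poly_Mapping.keys (f + g) \<subseteq> ?K" using keys_add[of f g] by auto
  show ?thesis
    unfolding substitute_superset[OF *] substitute_superset[OF *(1) Un_upper1]
      substitute_superset[OF *(1) Un_upper2]
    by (simp add: lookup_add hom_add algebra_simps sum.distrib)
qed

lemma substitute_zero: "substitute hom \<phi> 0 = 0"
  by (simp add: substitute_def)

lemma substitute_single: "substitute hom \<phi> (Poly_Mapping.single m c) = hom c * monomial_value \<phi> m"
  using substitute_superset[of "{m}" "Poly_Mapping.single m c"] by simp

lemma substitute_sum: "substitute hom \<phi> (\<Sum>i\<in>I. f i) = (\<Sum>i\<in>I. substitute hom \<phi> (f i))"
  by (induction I rule: infinite_finite_induct) (simp_all add: substitute_zero substitute_add)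

lemma substitute_mult: "substitute hom \<phi> (f * g) = substitute hom \<phi> f * substitute hom \<phi> g"
proof -
  have "f * g = (\<Sum>a\<in>Poly_Mapping.keys f. \<Sum>b\<in>Poly_Mapping.keys g.
      Poly_Mapping.single (a + b) (Poly_Mapping.lookup f a * Poly_Mapping.lookup g b))"
    by (subst (1) mpoly_eq_sum_single[of f], subst (1) mpoly_eq_sum_single[of g])
      (simp add: sum_product mult_single)
  also have "substitute hom \<phi> \<dots> = substitute hom \<phi> f * substitute hom \<phi> g"
    by (simp add: substitute_sum substitute_single monomial_value_add hom_mult
        substitute_def[of _ _ f] substitute_def[of _ _ g] sum_product mult_ac)
  finally show ?thesis .
qed

lemma substitute_one: "substitute hom \<phi> 1 = 1"
  by (simp flip: single_one add: substitute_single monomial_value_def)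

lemma substitute_Const: "substitute hom \<phi> (Const c) = hom c"
  by (simp add: Const_def substitute_single monomial_value_def)

lemma substitute_Var: "substitute hom \<phi> (Var x) = \<phi> x"
  by (simp add: Var_def substitute_single monomial_value_def)

lemma comm_ring_hom_substitute: "comm_ring_hom (substitute hom \<phi>)"
  by unfold_locales
    (simp_all add: substitute_zero substitute_add substitute_mult substitute_one)

end

section \<open>Subalgebras generated by a set\<close>

lemma is_subalgebra_generated: "is_subalgebra R (generated_algebra R S)"
  unfolding generated_algebra_def by (rule hull_in) (auto simp: is_subalgebra_def)

lemma generated_algebra_inc: "x \<in> S \<Longrightarrow> x \<in> generated_algebra R S"
  unfolding generated_algebra_def by (rule hull_inc)

lemma generated_algebra_subset:
  "S \<subseteq> A \<Longrightarrow> is_subalgebra R A \<Longrightarrow> generated_algebra R S \<subseteq> A"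
  unfolding generated_algebra_def by (rule hull_minimal)

context
  fixes R :: "'a::comm_ring_1 set" and A :: "('v, 'a) mpoly set"
  assumes A: "is_subalgebra R A"
begin

lemma subalgebra_Const: "c \<in> R \<Longrightarrow> Const c \<in> A"
  and subalgebra_add: "f \<in> A \<Longrightarrow> g \<in> A \<Longrightarrow> f + g \<in> A"
  and subalgebra_mult: "f \<in> A \<Longrightarrow> g \<in> A \<Longrightarrow> f * g \<in> A"
  using A by (auto simp: is_subalgebra_def)

lemma subalgebra_sum:
  assumes "0 \<in> R" "\<And>i. i \<in> I \<Longrightarrow> f i \<in> A"
  shows "sum f I \<in> A"
  using assms(2)
  by (induction I rule: infinite_finite_induct)
    (use subalgebra_Const[OF assms(1)] in \<open>auto simp: Const_def subalgebra_add\<close>)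

lemma subalgebra_prod:
  assumes "1 \<in> R" "\<And>i. i \<in> I \<Longrightarrow> f i \<in> A"
  shows "prod f I \<in> A"
  using assms(2)
  by (induction I rule: infinite_finite_induct)
    (use subalgebra_Const[OF assms(1)] in \<open>auto simp: Const_def subalgebra_mult\<close>)

lemma subalgebra_power:
  assumes "1 \<in> R" "f \<in> A"
  shows "f ^ k \<in> A"
  using subalgebra_prod[of "{..<k}" "\<lambda>_. f"] assms by simp

end

lemma monomial_value_Var:
  fixes m :: "'v \<Rightarrow>\<^sub>0 nat"
  shows "monomial_value (\<lambda>x. if x \<in> V then Var x else 0) m =
    (if Poly_Mapping.keys m \<subseteq> V then Poly_Mapping.single m (1::'a::comm_ring_1) else 0)"
proof (cases "Poly_Mapping.keys m \<subseteq> V")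
  case True
  have pow: "Var x ^ k = (Poly_Mapping.single (Poly_Mapping.single x k) 1 :: ('v, 'a) mpoly)" for x k
    by (induction k) (simp_all add: Var_def mult_single flip: single_add)
  have prod: "(\<Prod>x\<in>K. Poly_Mapping.single (a x) 1) = (Poly_Mapping.single (\<Sum>x\<in>K. a x) 1 :: ('v, 'a) mpoly)"
    for a and K :: "'v set"
    by (induction K rule: infinite_finite_induct) (simp_all add: mult_single)
  have "monomial_value (\<lambda>x. if x \<in> V then Var x else 0) m
      = (\<Prod>x\<in>Poly_Mapping.keys m.
          Poly_Mapping.single (Poly_Mapping.single x (Poly_Mapping.lookup m x)) (1::'a))"
    unfolding monomial_value_def pow[symmetric] by (rule prod.cong) (use True in auto)
  also have "\<dots> = Poly_Mapping.single m 1"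
  proof -
    have "(\<Sum>x\<in>Poly_Mapping.keys m. Poly_Mapping.single x (Poly_Mapping.lookup m x)) = m"
    proof (rule poly_mapping_eqI)
      fix k
      have "(\<Sum>x\<in>Poly_Mapping.keys m. Poly_Mapping.lookup (Poly_Mapping.single x (Poly_Mapping.lookup m x)) k)
          = (\<Sum>x\<in>Poly_Mapping.keys m. if x = k then Poly_Mapping.lookup m x else 0)"
        by (intro sum.cong) (auto simp: lookup_single when_def)
      then show "Poly_Mapping.lookup (\<Sum>x\<in>Poly_Mapping.keys m.
          Poly_Mapping.single x (Poly_Mapping.lookup m x)) k = Poly_Mapping.lookup m k"
        by (simp add: lookup_sum in_keys_iff)
    qed
    then show ?thesis unfolding prod by simp
  qed
  finally show ?thesis using True by simp
next
  case False
  then obtain x where "x \<in> Poly_Mapping.keys m" "x \<notin> V" by blast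
  then have "monomial_value (\<lambda>x. if x \<in> V then Var x else (0 :: ('v, 'a) mpoly)) m = 0"
    unfolding monomial_value_def by (intro prod_zero bexI[of _ x]) (auto simp: in_keys_iff zero_power)
  then show ?thesis using False by simp
qed

section \<open>Arithmetic of the integers localized at p\<close>

lemma of_int_mem_localized_ints: "prime p \<Longrightarrow> of_int c \<in> localized_ints p"
  unfolding localized_ints_def
  by (rule CollectI, rule exI[of _ c], rule exI[of _ 1]) (auto dest: prime_gt_1_nat)

lemma localized_ints_add:
  assumes p: "prime p" and "x \<in> localized_ints p" "y \<in> localized_ints p"
  shows "x + y \<in> localized_ints p"
proof -
  from assms obtain a b c d where *: "x = of_int a / of_int b" "y = of_int c / of_int d"
    "\<not> int p dvd b" "\<not> int p dvd d"
    by (auto simp: localized_ints_def)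
  then have "b \<noteq> 0" "d \<noteq> 0" by auto
  then have "x + y = of_int (a * d + c * b) / of_int (b * d)" by (simp add: * field_simps)
  moreover have "\<not> int p dvd b * d"
    using * p by (simp add: prime_dvd_mult_iff)
  ultimately show ?thesis unfolding localized_ints_def by blast
qed

lemma localized_ints_mult:
  assumes p: "prime p" and "x \<in> localized_ints p" "y \<in> localized_ints p"
  shows "x * y \<in> localized_ints p"
proof -
  from assms obtain a b c d where *: "x = of_int a / of_int b" "y = of_int c / of_int d"
    "\<not> int p dvd b" "\<not> int p dvd d"
    by (auto simp: localized_ints_def)
  then have "x * y = of_int (a * c) / of_int (b * d)" by simp
  moreover have "\<not> int p dvd b * d"
    using * p by (simp add: prime_dvd_mult_iff)
  ultimately show ?thesis unfolding localized_ints_def by blast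
qed

lemma localized_ints_sum:
  assumes p: "prime p" and "\<And>i. i \<in> I \<Longrightarrow> f i \<in> localized_ints p"
  shows "sum f I \<in> localized_ints p"
  using assms(2) of_int_mem_localized_ints[OF p, of 0]
  by (induction I rule: infinite_finite_induct) (auto intro: localized_ints_add[OF p])

text \<open>Says that p is not a unit in the localized ring; this produces the final
  contradiction.\<close>

lemma p_mult_localized_ints:
  assumes p: "prime p" and "x \<in> localized_ints p" and "\<bar>of_nat p * x\<bar> = 1"
  shows False
proof -
  from assms obtain a b where *: "x = of_int a / of_int b" "\<not> int p dvd b"
    by (auto simp: localized_ints_def)
  then have "b \<noteq> 0" by auto
  then have "\<bar>rat_of_int (int p * a)\<bar> = \<bar>of_int b\<bar>"
    using assms(3) by (simp add: * abs_mult field_simps)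
  then have "\<bar>int p * a\<bar> = \<bar>b\<bar>" by linarith
  then have "int p dvd \<bar>b\<bar>" by (metis dvd_abs_iff dvd_triv_left)
  then show False using * by simp
qed

lemma localized_intsI:
  assumes "\<not> int p dvd denominator c"
  shows "c \<in> localized_ints p"
proof -
  obtain a b where ab: "quotient_of c = (a, b)" by force
  then have "c = of_int a / of_int b" by (rule quotient_of_div)
  then show ?thesis using assms ab by (auto simp: localized_ints_def denominator_def)
qed

lemma evaluate_mem_generated_algebra:
  assumes F: "F \<in> polynomials S" and "1 \<in> R" "0 \<in> R"
    and coeffs: "\<And>m. m \<in> Poly_Mapping.keys F \<Longrightarrow> Poly_Mapping.lookup F m \<in> R"
  shows "evaluate F \<in> generated_algebra R S"
  unfolding evaluate_def
proof (rule subalgebra_sum[OF is_subalgebra_generated \<open>0 \<in> R\<close>])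
  fix m assume m: "m \<in> Poly_Mapping.keys F"
  have "(\<Prod>x\<in>Poly_Mapping.keys m. x ^ Poly_Mapping.lookup m x) \<in> generated_algebra R S"
  proof (rule subalgebra_prod[OF is_subalgebra_generated \<open>1 \<in> R\<close>])
    fix x assume "x \<in> Poly_Mapping.keys m"
    then have "x \<in> S" using F m by (auto simp: polynomials_def)
    then show "x ^ Poly_Mapping.lookup m x \<in> generated_algebra R S"
      by (intro subalgebra_power[OF is_subalgebra_generated \<open>1 \<in> R\<close>] generated_algebra_inc)
  qed
  then show "Const (Poly_Mapping.lookup F m) * (\<Prod>x\<in>Poly_Mapping.keys m. x ^ Poly_Mapping.lookup m x)
      \<in> generated_algebra R S"
    by (intro subalgebra_mult[OF is_subalgebra_generated]
        subalgebra_Const[OF is_subalgebra_generated] coeffs m)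
qed

section \<open>A specialization of the generic matrix\<close>

lemma det_zero_column:
  assumes "A \<in> carrier_mat n n" "j < n" "\<And>i. i < n \<Longrightarrow> A $$ (i, j) = 0"
  shows "det (A :: 'a::comm_ring_1 mat) = 0"
  using laplace_expansion_column[OF assms(1,2)] assms(3) by simp

lemma det_zero_row:
  assumes "A \<in> carrier_mat n n" "i < n" "\<And>j. j < n \<Longrightarrow> A $$ (i, j) = 0"
  shows "det (A :: 'a::comm_ring_1 mat) = 0"
  using laplace_expansion_row[OF assms(1,2)] assms(3) by simp

lemma pick_lessThan: "k < t \<Longrightarrow> pick {..<t} k = k"
proof -
  assume "k < t"
  then have "{a \<in> {..<t}. a < k} = {..<k}" by auto
  then show ?thesis using pick_card_in_set[of k "{..<t}"] \<open>k < t\<close> by simp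
qed

lemma pick_omit:
  assumes "c < t" "j \<le> t"
  shows "pick ({..t} - {j}) c = (if c < j then c else Suc c)"
proof -
  let ?i = "if c < j then c else Suc c"
  have "{a \<in> {..t} - {j}. a < ?i} = (if c < j then {..<c} else {..<Suc c} - {j})"
    using assms by auto
  then have "card {a \<in> {..t} - {j}. a < ?i} = c" by auto
  then show ?thesis using pick_card_in_set[of ?i "{..t} - {j}"] assms by (auto split: if_splits)
qed

lemma submatrix_generic_matrix:
  assumes "J \<subseteq> {..<n}" "card J = t"
  shows "submatrix (generic_matrix t n) {..<t} J = mat t t (\<lambda>(k, c). Var (k, pick J c))"
proof -
  have 1: "{i. i < dim_row (generic_matrix t n) \<and> i \<in> {..<t}} = {..<t}"
    by (auto simp: generic_matrix_def)
  have 2: "{j. j < dim_col (generic_matrix t n) \<and> j \<in> J} = J"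
    using assms by (auto simp: generic_matrix_def)
  have "pick J c < n" if "c < t" for c
    using assms pick_in_set_le[of c J] that by auto
  then show ?thesis
    unfolding submatrix_def 1 2 by (intro eq_matI) (auto simp: assms generic_matrix_def pick_lessThan)
qed

lemma minors_generic_matrixE:
  assumes "x \<in> minors t (generic_matrix t n)"
  obtains J where "J \<subseteq> {..<n}" "card J = t" "x = det (mat t t (\<lambda>(k, c). Var (k, pick J c)))"
proof -
  from assms obtain I J where *: "x = det (submatrix (generic_matrix t n) I J)"
    "I \<subseteq> {..<t}" "J \<subseteq> {..<n}" "card I = t" "card J = t"
    by (auto simp: minors_def generic_matrix_def)
  then have "I = {..<t}" by (intro card_subset_eq) auto
  with * that show ?thesis by (metis submatrix_generic_matrix)
qed

lemma omit_det_mem_minors: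
  assumes "j \<le> t" "t < n"
  shows "(omit_det t (\<lambda>j k. Var (k, j)) j :: (nat \<times> nat, 'a::comm_ring_1) mpoly)
    \<in> minors t (generic_matrix t n)"
proof -
  let ?J = "{..t} - {j}"
  have J: "?J \<subseteq> {..<n}" "card ?J = t" using assms by auto
  have "(mat t t (\<lambda>(k, c). Var (k, if c < j then c else Suc c)) :: (nat \<times> nat, 'a) mpoly mat)
      = submatrix (generic_matrix t n) {..<t} ?J"
    unfolding submatrix_generic_matrix[OF J] using assms
    by (intro eq_matI) (auto simp: pick_omit)
  then have "(omit_det t (\<lambda>j k. Var (k, j)) j :: (nat \<times> nat, 'a) mpoly) = det (submatrix (generic_matrix t n) {..<t} ?J)"
    by (simp add: omit_det_def)
  moreover have "{..<t} \<subseteq> {..<dim_row (generic_matrix t n)}" "?J \<subseteq> {..<dim_col (generic_matrix t n)}"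
    using J by (simp_all add: generic_matrix_def)
  ultimately show ?thesis using J unfolding minors_def by (intro CollectI exI[of _ "{..<t}"] exI[of _ ?J]) simp
qed

text \<open>Represents a s^i v^j w^k in Q[w][v][s], with s as the outermost variable.\<close>

definition mono3 :: "rat \<Rightarrow> nat \<Rightarrow> nat \<Rightarrow> nat \<Rightarrow> rat poly poly poly" where
  "mono3 a i j k = monom (monom (monom a k) j) i"

definition coeff3 :: "rat poly poly poly \<Rightarrow> nat \<Rightarrow> nat \<Rightarrow> nat \<Rightarrow> rat" where
  "coeff3 f i j k = coeff (coeff (coeff f i) j) k"

lemma mono3_mult: "mono3 a i j k * mono3 b i' j' k' = mono3 (a * b) (i + i') (j + j') (k + k')"
  by (simp add: mono3_def mult_monom)

lemma mono3_one: "mono3 1 0 0 0 = 1"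
  by (simp add: mono3_def)

lemma mono3_power: "mono3 a i j k ^ n = mono3 (a ^ n) (n * i) (n * j) (n * k)"
  by (simp add: mono3_def monom_power mult.commute)

lemma coeff3_mono3_mult: "coeff3 (mono3 a i j k * f) i' j' k' =
    (if i' < i \<or> j' < j \<or> k' < k then 0 else a * coeff3 f (i' - i) (j' - j) (k' - k))"
  by (simp add: coeff3_def mono3_def coeff_monom_mult)

lemma coeff3_mono3: "coeff3 (mono3 a i j k) i' j' k' = (if i = i' \<and> j = j' \<and> k = k' then a else 0)"
  by (simp add: coeff3_def mono3_def)

lemma coeff3_add: "coeff3 (f + g) i j k = coeff3 f i j k + coeff3 g i j k"
  by (simp add: coeff3_def)

lemma coeff3_sum: "coeff3 (\<Sum>x\<in>X. f x) i j k = (\<Sum>x\<in>X. coeff3 (f x) i j k)"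
  by (simp add: coeff3_def coeff_sum)

lemma coeff3_mult: "coeff3 (f * g) i j k =
    (\<Sum>i'\<le>i. \<Sum>j'\<le>j. \<Sum>k'\<le>k. coeff3 f i' j' k' * coeff3 g (i - i') (j - j') (k - k'))"
  by (simp add: coeff3_def coeff_mult coeff_sum)

text \<open>Contains the images of all maximal minors under the specialization below, where the third
  variable \<open>w\<close> occurs only through \<open>s w\<close>.\<close>

definition spec_ring :: "nat \<Rightarrow> rat poly poly poly set" where
  "spec_ring p = {f. \<forall>i j k. coeff3 f i j k \<in> localized_ints p \<and> (i < k \<longrightarrow> coeff3 f i j k = 0)}"

lemma spec_ring_add:
  assumes "prime p" "f \<in> spec_ring p" "g \<in> spec_ring p"
  shows "f + g \<in> spec_ring p"
  using assms by (auto simp: spec_ring_def coeff3_add localized_ints_add)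

lemma spec_ring_mult:
  assumes "prime p" "f \<in> spec_ring p" "g \<in> spec_ring p"
  shows "f * g \<in> spec_ring p"
proof -
  have "coeff3 (f * g) i j k \<in> localized_ints p" for i j k
    unfolding coeff3_mult using assms
    by (intro localized_ints_sum localized_ints_mult) (auto simp: spec_ring_def)
  moreover have "coeff3 (f * g) i j k = 0" if "i < k" for i j k
    unfolding coeff3_mult
  proof (intro sum.neutral ballI)
    fix i' j' k' assume "i' \<in> {..i}" "k' \<in> {..k}"
    \<comment> \<open>An excess of w over s in a product forces such an excess in one of the two
      factors.\<close>
    with that have "i' < k' \<or> i - i' < k - k'" by auto
    then show "coeff3 f i' j' k' * coeff3 g (i - i') (j - j') (k - k') = 0"
      using assms(2,3) by (auto simp: spec_ring_def)
  qed
  ultimately show ?thesis by (simp add: spec_ring_def)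
qed

lemma mono3_mem_spec_ring:
  "prime p \<Longrightarrow> a \<in> localized_ints p \<Longrightarrow> k \<le> i \<Longrightarrow> mono3 a i j k \<in> spec_ring p"
  using of_int_mem_localized_ints[of p 0] by (auto simp: spec_ring_def coeff3_mono3)

text \<open>Columns \<open>(s, 0)\<close>, \<open>(0, 1)\<close>, \<open>(v, w)\<close> in the first two rows, and the identity block below;
  the three surviving maximal minors are \<open>-v\<close>, \<open>s w\<close>, \<open>s\<close>.\<close>

definition special :: "nat \<Rightarrow> nat \<Rightarrow> nat \<Rightarrow> rat poly poly poly" where
  "special t j k =
    (if j = 0 then (if k = 0 then mono3 1 1 0 0 else 0)
     else if j = 1 then (if k = 1 then 1 else 0)
     else if j = 2 then (if k = 0 then mono3 1 0 1 0 else if k = 1 then mono3 1 0 0 1 else 0)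
     else if j \<le> t \<and> k = j - 1 then 1 else 0)"

lemma det_lower_triangular_mat:
  assumes "A \<in> carrier_mat n n" "\<And>i j. i < j \<Longrightarrow> j < n \<Longrightarrow> A $$ (i, j) = 0"
  shows "det (A :: 'a::comm_ring_1 mat) = (\<Prod>i<n. A $$ (i, i))"
  using det_lower_triangular[OF assms(2,1)] assms(1)
  by (simp add: prod_list_diag_prod atLeast0LessThan)

lemma det_upper_triangular_mat:
  assumes "A \<in> carrier_mat n n" "\<And>i j. j < i \<Longrightarrow> i < n \<Longrightarrow> A $$ (i, j) = 0"
  shows "det (A :: 'a::comm_ring_1 mat) = (\<Prod>i<n. A $$ (i, i))"
  using det_upper_triangular[OF _ assms(1)] assms
  by (auto simp: upper_triangular_def prod_list_diag_prod atLeast0LessThan)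

lemma prod_first_two:
  assumes "2 \<le> t" "\<And>i. 2 \<le> i \<Longrightarrow> i < t \<Longrightarrow> f i = 1"
  shows "(\<Prod>i<t. f i) = f 0 * f (1 :: nat)"
proof -
  have "(\<Prod>i<t. f i) = (\<Prod>i<2. f i)"
    by (rule prod.mono_neutral_right) (use assms in auto)
  then show ?thesis by (simp add: numeral_2_eq_2)
qed

text \<open>Omitting column 1 or 2 leaves an upper triangular matrix. Omitting column 0 leaves a
  lower triangular one after the first two columns are exchanged, which explains the sign.\<close>

lemma omit_det_special:
  assumes t: "2 \<le> t"
  shows "omit_det t (special t) 0 = mono3 (- 1) 0 1 0"
    and "omit_det t (special t) 1 = mono3 1 1 0 1"
    and "omit_det t (special t) 2 = mono3 1 1 0 0"
proof -
  note [simp] = special_def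
  have "bracket t (special t) (special t 2) (special t 1) =
      (\<Prod>i<t. bracket_mat t (special t) (special t 2) (special t 1) $$ (i, i))"
    unfolding bracket_def[OF t]
    by (rule det_lower_triangular_mat[OF bracket_mat_carrier[OF t]]) (auto simp: bracket_mat_def[OF t])
  also have "\<dots> = mono3 1 0 1 0"
    by (subst prod_first_two[OF t]) (use t in \<open>auto simp: bracket_mat_def[OF t]\<close>)
  finally show "omit_det t (special t) 0 = mono3 (- 1) 0 1 0"
    using omit_det_bracket(1)[OF t, of "special t" "special t"]
      bracket_swap[OF t, of "special t" "special t 1" "special t 2"]
    by (simp add: mono3_def minus_monom monom_0)
  have "omit_det t (special t) 1 = (\<Prod>i<t. special t (if i < 1 then i else Suc i) i)"
    unfolding omit_det_def by (subst det_upper_triangular_mat[where n = t]) auto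
  also have "\<dots> = mono3 1 1 0 1"
    by (subst prod_first_two[OF t]) (auto simp: mono3_mult)
  finally show "omit_det t (special t) 1 = mono3 1 1 0 1" .
  have "omit_det t (special t) 2 = (\<Prod>i<t. special t (if i < 2 then i else Suc i) i)"
    unfolding omit_det_def by (subst det_upper_triangular_mat[where n = t]) auto
  also have "\<dots> = mono3 1 1 0 0"
    by (subst prod_first_two[OF t]) auto
  finally show "omit_det t (special t) 2 = mono3 1 1 0 0" .
qed

text \<open>The only nonzero entry of row j - 1 lies in the omitted column.\<close>

lemma omit_det_special_zero:
  assumes "3 \<le> j" "j \<le> t"
  shows "omit_det t (special t) j = 0"
  unfolding omit_det_def
  by (rule det_zero_row[where n = t and i = "j - 1"]) (use assms in \<open>auto simp: special_def\<close>)

text \<open>A minor that uses a column beyond t has a zero column; any other minor omits exactly one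
  of the first t + 1 columns.\<close>

lemma special_minor_mem:
  assumes p: "prime p" and t: "2 \<le> t" and J: "finite J" "card J = t"
  shows "det (mat t t (\<lambda>(k, c). special t (pick J c) k)) \<in> spec_ring p"
proof (cases "J \<subseteq> {..t}")
  case True
  then have "card ({..t} - J) = 1" using J by (simp add: card_Diff_subset)
  then obtain j where j: "{..t} - J = {j}" by (auto simp: card_1_singleton_iff)
  then have Jj: "J = {..t} - {j}" "j \<le> t" using True by auto
  have "mat t t (\<lambda>(k, c). special t (pick J c) k)
      = mat t t (\<lambda>(k, c). special t (if c < j then c else Suc c) k)"
    unfolding Jj(1) by (intro eq_matI) (auto simp: pick_omit Jj(2))
  then have eq: "det (mat t t (\<lambda>(k, c). special t (pick J c) k)) = omit_det t (special t) j"
    by (simp add: omit_det_def)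
  consider "j = 0" | "j = 1" | "j = 2" | "3 \<le> j" by arith
  then have "omit_det t (special t) j \<in> spec_ring p"
  proof cases
    case 4
    then have "omit_det t (special t) j = mono3 0 0 0 0"
      using omit_det_special_zero Jj by (simp add: mono3_def)
    then show ?thesis using p of_int_mem_localized_ints[OF p, of 0] by (simp add: mono3_mem_spec_ring)
  qed (use p of_int_mem_localized_ints[OF p, of 1] of_int_mem_localized_ints[OF p, of "-1"]
      omit_det_special[OF t] in \<open>simp_all add: mono3_mem_spec_ring\<close>)
  then show ?thesis unfolding eq .
next
  case False
  then obtain j where j: "j \<in> J" "t < j" by (auto simp: subset_iff not_le)
  define c where "c = card {a \<in> J. a < j}"
  have "c < t"
    unfolding c_def J(2)[symmetric] by (rule psubset_card_mono) (use J j in auto)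
  moreover have "pick J c = j" unfolding c_def by (rule pick_card_in_set[OF j(1)])
  ultimately have "det (mat t t (\<lambda>(k, c). special t (pick J c) k)) = 0"
    by (intro det_zero_column[where n = t and j = c]) (use j t in \<open>auto simp: special_def\<close>)
  also have "0 = mono3 0 0 0 0" by (simp add: mono3_def)
  finally show ?thesis using p of_int_mem_localized_ints[OF p, of 0] by (simp add: mono3_mem_spec_ring)
qed

text \<open>Compare coefficients of s^p v^(p-1) w^(p-1): the left side has 1 or -1. The power of D 0
  has too much v, that of D 1 too much w, and that of D 2 uses up all of s while w remains, so the
  right side contributes only a multiple of p.\<close>

lemma omit_det_not_in_power_ideal:
  assumes p: "prime p" and t: "2 \<le> t"
    and g: "\<And>j. g j \<in> spec_ring p" and h: "h \<in> spec_ring p"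
    and D: "D = omit_det t (special t)"
    and eq: "D 0 ^ (p - 1) * D 1 ^ (p - 1) * D 2 = (\<Sum>j<Suc t. D j ^ p * g j) + of_nat p * h"
  shows False
proof -
  have p2: "2 \<le> p" using prime_ge_2_nat[OF p] .
  have D012: "D 0 = mono3 (- 1) 0 1 0" "D 1 = mono3 1 1 0 1" "D 2 = mono3 1 1 0 0"
    unfolding D by (rule omit_det_special[OF t])+
  have "coeff3 (D j ^ p * g j) p (p - 1) (p - 1) = 0" if j: "j < Suc t" for j
  proof -
    consider "j = 0" | "j = 1" | "j = 2" | "3 \<le> j" by arith
    then show ?thesis
    proof cases
      case 3
      \<comment> \<open>Here w has exponent p - 1 > 0 but s has exponent 0, which
        \<open>spec_ring\<close> excludes.\<close>
      have "coeff3 (g j) 0 (p - 1) (p - 1) = 0"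
        using g[of j] p2 by (auto simp: spec_ring_def)
      then show ?thesis unfolding 3 D012 mono3_power coeff3_mono3_mult by simp
    next
      case 4
      then have "D j = 0" using omit_det_special_zero j D by simp
      then show ?thesis using p2 by (simp add: coeff3_def zero_power)
    qed (use p2 in \<open>simp_all only: D012 mono3_power coeff3_mono3_mult, simp_all\<close>)
  qed
  then have "coeff3 (\<Sum>j<Suc t. D j ^ p * g j) p (p - 1) (p - 1) = 0"
    unfolding coeff3_sum by (intro sum.neutral) auto
  moreover have "D 0 ^ (p - 1) * D 1 ^ (p - 1) * D 2 = mono3 ((- 1) ^ (p - 1)) p (p - 1) (p - 1)"
    unfolding D012 mono3_power mono3_mult using p2 by simp
  moreover have "(of_nat p :: rat poly poly poly) = mono3 (of_nat p) 0 0 0"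
    by (simp add: mono3_def monom_0 of_nat_poly)
  ultimately have "(- 1) ^ (p - 1) = of_nat p * coeff3 h p (p - 1) (p - 1)"
    using arg_cong[OF eq, of "\<lambda>f. coeff3 f p (p - 1) (p - 1)"]
    by (simp add: coeff3_add coeff3_mono3 coeff3_mono3_mult)
  then have "\<bar>of_nat p * coeff3 h p (p - 1) (p - 1)\<bar> = 1"
    by (metis abs_minus_cancel abs_one power_abs power_one)
  then show False using p_mult_localized_ints[OF p] h by (auto simp: spec_ring_def)
qed

section \<open>Splittings\<close>

lemma polynomials_add: "f \<in> polynomials V \<Longrightarrow> g \<in> polynomials V \<Longrightarrow> f + g \<in> polynomials V"
  using keys_add[of f g] by (auto simp: polynomials_def)

text \<open>The multipliers in the integral relation may involve any variable of the type. Setting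
  those outside V to zero brings them into the domain of the splitting and fixes the matrix
  entries.\<close>

definition restrict_rat :: "'v set \<Rightarrow> ('v, int) mpoly \<Rightarrow> ('v, rat) mpoly" where
  "restrict_rat V = substitute of_int (\<lambda>x. if x \<in> V then Var x else 0)"

lemma comm_ring_hom_restrict_rat: "comm_ring_hom (restrict_rat V)"
  unfolding restrict_rat_def by (rule of_int_hom.comm_ring_hom_substitute)

lemma restrict_rat_Var: "restrict_rat V (Var x) = (if x \<in> V then Var x else 0)"
  unfolding restrict_rat_def by (rule of_int_hom.substitute_Var)

text \<open>The image of an integer polynomial is an integer combination of monomials in V.
  Constants lie in the subalgebra, so the splitting is determined on it by its values at these
  monomials.\<close>

lemma splitting_restrict_rat:
  fixes V :: "'v set"
  assumes p: "prime p"
    and split: "is_linear_splitting (generated_algebra UNIV \<Delta>) (polynomials V) \<pi>"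
    and integral: "\<And>\<mu>. \<mu> \<in> monomials V \<Longrightarrow> \<pi> \<mu> \<in> generated_algebra (localized_ints p) \<Delta>"
  shows "restrict_rat V f \<in> polynomials V \<and>
    \<pi> (restrict_rat V f) \<in> generated_algebra (localized_ints p) \<Delta>"
proof -
  let ?R = "generated_algebra (UNIV :: rat set) \<Delta>" and ?Rp = "generated_algebra (localized_ints p) \<Delta>"
  let ?G = "{f \<in> polynomials V. \<pi> f \<in> ?Rp}"
  have sub: "is_subalgebra UNIV ?R" "is_subalgebra (localized_ints p) ?Rp"
    by (rule is_subalgebra_generated)+
  have G_add: "f + g \<in> ?G" if "f \<in> ?G" "g \<in> ?G" for f g
    using that split subalgebra_add[OF sub(2)]
    by (auto simp: is_linear_splitting_def polynomials_add)
  have "Const 0 \<in> ?R" by (rule subalgebra_Const[OF sub(1)]) simp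
  then have "\<pi> 0 = 0" using split by (auto simp: is_linear_splitting_def Const_def)
  moreover have "Const 0 \<in> ?Rp"
    using subalgebra_Const[OF sub(2) of_int_mem_localized_ints[OF p, of 0]] by simp
  ultimately have G_0: "0 \<in> ?G" by (simp add: polynomials_def Const_def)
  have G_sum: "sum u I \<in> ?G" if "\<And>i. i \<in> I \<Longrightarrow> u i \<in> ?G" for u and I :: "('v \<Rightarrow>\<^sub>0 nat) set"
    using that by (induction I rule: infinite_finite_induct) (use G_0 G_add in auto)
  have "of_int c * monomial_value (\<lambda>x. if x \<in> V then Var x else 0) m \<in> ?G" for c m
  proof (cases "Poly_Mapping.keys m \<subseteq> V")
    case True
    let ?\<mu> = "Poly_Mapping.single m 1 :: ('v, rat) mpoly"
    have \<mu>: "?\<mu> \<in> monomials V" "?\<mu> \<in> polynomials V"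
      using True by (auto simp: monomials_def polynomials_def)
    have c: "(of_int c :: ('v, rat) mpoly) = Const (of_int c)"
      by (simp add: Const_def)
    have "Const (of_int c) \<in> ?R" by (rule subalgebra_Const[OF sub(1)]) simp
    then have "\<pi> (Const (of_int c) * ?\<mu>) = Const (of_int c) * \<pi> ?\<mu>"
      using split \<mu> by (auto simp: is_linear_splitting_def)
    moreover have "Const (of_int c) * \<pi> ?\<mu> \<in> ?Rp"
      by (intro subalgebra_mult[OF sub(2)] subalgebra_Const[OF sub(2)]
          of_int_mem_localized_ints[OF p] integral \<mu>)
    moreover have "Const (of_int c) * ?\<mu> \<in> polynomials V"
    proof -
      have "Const a * ?\<mu> = Poly_Mapping.single m a" for a
        by (simp add: Const_def mult_single)
      then show ?thesis using True by (auto simp: polynomials_def)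
    qed
    ultimately show ?thesis using True by (simp add: monomial_value_Var c)
  next
    case False
    then show ?thesis using G_0 by (simp add: monomial_value_Var)
  qed
  then have "restrict_rat V f \<in> ?G"
    unfolding restrict_rat_def substitute_def by (intro G_sum)
  then show ?thesis by simp
qed

definition specialize :: "nat \<Rightarrow> (nat \<times> nat, rat) mpoly \<Rightarrow> rat poly poly poly" where
  "specialize t = substitute (\<lambda>c. mono3 c 0 0 0) (\<lambda>(k, j). special t j k)"

lemma comm_ring_hom_mono3: "comm_ring_hom (\<lambda>c. mono3 c 0 0 0)"
  by unfold_locales (simp_all add: mono3_mult mono3_one, simp_all add: mono3_def add_monom)

lemma comm_ring_hom_specialize: "comm_ring_hom (specialize t)"
  unfolding specialize_def
  by (rule comm_ring_hom.comm_ring_hom_substitute[OF comm_ring_hom_mono3])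

lemma specialize_Var: "specialize t (Var (k, j)) = special t j k"
  unfolding specialize_def
  using comm_ring_hom.substitute_Var[OF comm_ring_hom_mono3, of "\<lambda>(k, j). special t j k" "(k, j)"] by simp

lemma specialize_Const: "specialize t (Const c) = mono3 c 0 0 0"
  unfolding specialize_def by (rule comm_ring_hom.substitute_Const[OF comm_ring_hom_mono3])

lemma hom_omit_det:
  assumes "comm_ring_hom \<phi>" "j \<le> t"
    and "\<And>k i. k < t \<Longrightarrow> i \<le> t \<Longrightarrow> \<phi> (y i k) = z i k"
  shows "\<phi> (omit_det t y j) = omit_det t z j"
proof -
  have "map_mat \<phi> (mat t t (\<lambda>(k, c). y (if c < j then c else Suc c) k))
      = mat t t (\<lambda>(k, c). z (if c < j then c else Suc c) k)"
    by (rule eq_matI) (use assms in auto)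
  then show ?thesis
    unfolding omit_det_def comm_ring_hom.hom_det[OF assms(1), symmetric] by simp
qed

text \<open>The preimage of \<open>spec_ring p\<close> is a subalgebra over the localized integers
  and contains the minors, hence everything they generate.\<close>

lemma specialize_mem_spec_ring:
  assumes p: "prime p" and t: "2 \<le> t"
    and f: "f \<in> generated_algebra (localized_ints p) (minors t (generic_matrix t n))"
  shows "specialize t f \<in> spec_ring p"
proof -
  interpret comm_ring_hom "specialize t" by (rule comm_ring_hom_specialize)
  have "generated_algebra (localized_ints p) (minors t (generic_matrix t n))
      \<subseteq> {f. specialize t f \<in> spec_ring p}"
  proof (rule generated_algebra_subset)
    show "is_subalgebra (localized_ints p) {f. specialize t f \<in> spec_ring p}"
      unfolding is_subalgebra_def
      by (auto simp: specialize_Const hom_add hom_mult p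
          intro!: mono3_mem_spec_ring spec_ring_add spec_ring_mult)
    show "minors t (generic_matrix t n) \<subseteq> {f. specialize t f \<in> spec_ring p}"
    proof
      fix x :: "(nat \<times> nat, rat) mpoly"
      assume "x \<in> minors t (generic_matrix t n)"
      then obtain J where J: "J \<subseteq> {..<n}" "card J = t"
        and x: "x = det (mat t t (\<lambda>(k, c). Var (k, pick J c)))"
        by (rule minors_generic_matrixE)
      have "map_mat (specialize t) (mat t t (\<lambda>(k, c). Var (k, pick J c)))
          = mat t t (\<lambda>(k, c). special t (pick J c) k)"
        by (rule eq_matI) (auto simp: specialize_Var)
      then have "specialize t x = det (mat t t (\<lambda>(k, c). special t (pick J c) k))"
        unfolding x hom_det[symmetric] by simp
      then show "x \<in> {f. specialize t f \<in> spec_ring p}"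
        using special_minor_mem[OF p t _ J(2)] J(1) finite_subset by auto
    qed
  qed
  with f show ?thesis by blast
qed

lemma no_integral_splitting:
  assumes p: "prime p" and t: "1 < t" "t < n"
    and \<Delta>: "\<Delta> = minors t (generic_matrix t n)"
    and split: "is_linear_splitting (generated_algebra UNIV \<Delta>) (polynomials (matrix_vars t n)) \<pi>"
  shows "\<exists>\<mu> \<in> monomials (matrix_vars t n). \<pi> \<mu> \<notin> generated_algebra (localized_ints p) \<Delta>"
proof (rule ccontr)
  let ?V = "matrix_vars t n"
  let ?R = "generated_algebra (UNIV :: rat set) \<Delta>" and ?Rp = "generated_algebra (localized_ints p) \<Delta>"
  assume "\<not> ?thesis"
  then have integral: "\<And>\<mu>. \<mu> \<in> monomials ?V \<Longrightarrow> \<pi> \<mu> \<in> ?Rp" by blast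
  have t2: "2 \<le> t" using t by simp
  define \<Psi> where "\<Psi> = restrict_rat ?V"
  interpret \<Psi>: comm_ring_hom \<Psi> unfolding \<Psi>_def by (rule comm_ring_hom_restrict_rat)
  interpret \<sigma>: comm_ring_hom "specialize t" by (rule comm_ring_hom_specialize)
  have \<Psi>: "\<Psi> f \<in> polynomials ?V" "\<pi> (\<Psi> f) \<in> ?Rp" for f
    using splitting_restrict_rat[OF p split integral] by (simp_all add: \<Psi>_def)
  have sub: "is_subalgebra UNIV ?R" by (rule is_subalgebra_generated)
  have \<pi>_add: "\<pi> (\<Psi> f + \<Psi> g) = \<pi> (\<Psi> f) + \<pi> (\<Psi> g)"
    and \<pi>_mult: "a \<in> ?R \<Longrightarrow> \<pi> (a * \<Psi> f) = a * \<pi> (\<Psi> f)"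
    and \<pi>_id: "a \<in> ?R \<Longrightarrow> \<pi> a = a" for f g a
    using split \<Psi>(1) by (auto simp: is_linear_splitting_def)
  have \<pi>_sum: "\<pi> (\<Psi> (\<Sum>j<N. u j)) = (\<Sum>j<N. \<pi> (\<Psi> (u j)))" for u and N :: nat
  proof (induction N)
    case 0
    have "Const 0 \<in> ?R" by (rule subalgebra_Const[OF sub]) simp
    then show ?case using \<pi>_id by (simp add: Const_def)
  qed (simp add: \<Psi>.hom_add \<pi>_add)
  define y :: "nat \<Rightarrow> nat \<Rightarrow> (nat \<times> nat, int) mpoly" where "y = (\<lambda>j k. Var (k, j))"
  define E :: "nat \<Rightarrow> (nat \<times> nat, rat) mpoly" where "E = omit_det t (\<lambda>j k. Var (k, j))"
  have E: "\<Psi> (omit_det t y j) = E j" if "j \<le> t" for j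
    unfolding E_def
    by (rule hom_omit_det[OF \<Psi>.comm_ring_hom_axioms that])
      (use t in \<open>auto simp: y_def \<Psi>_def restrict_rat_Var matrix_vars_def\<close>)
  have E_mem: "E j \<in> ?R" if "j \<le> t" for j
    unfolding E_def \<Delta> using omit_det_mem_minors[OF that t(2)] by (rule generated_algebra_inc)
  have E_power: "E j ^ k \<in> ?R" if "j \<le> t" for j k
    by (rule subalgebra_power[OF sub _ E_mem[OF that]]) simp
  have \<sigma>E: "specialize t (E j) = omit_det t (special t) j" if "j \<le> t" for j
    unfolding E_def by (rule hom_omit_det[OF \<sigma>.comm_ring_hom_axioms that]) (rule specialize_Var)
  \<comment> \<open>The relation is taken over the integers, so that f and h have integer
    coefficients and \<open>splitting_restrict_rat\<close> applies to them.\<close>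
  obtain f h where fh: "omit_det t y 0 ^ (p - 1) * omit_det t y 1 ^ (p - 1) * omit_det t y 2
      = (\<Sum>j<Suc t. f j * omit_det t y j ^ p) + of_nat p * h"
    using omit_det_power_combination[OF p t2] by blast
  let ?r = "E 0 ^ (p - 1) * E 1 ^ (p - 1) * E 2"
  have "of_nat p = (Const (of_nat p) :: (nat \<times> nat, rat) mpoly)" by (simp add: Const_def)
  then have p_mem: "of_nat p \<in> ?R" using subalgebra_Const[OF sub, of "of_nat p"] by simp
  have "?r = \<Psi> (omit_det t y 0 ^ (p - 1) * omit_det t y 1 ^ (p - 1) * omit_det t y 2)"
    using E[of 0] E[of 1] E[of 2] t by (simp add: \<Psi>.hom_mult \<Psi>.hom_power)
  also have "\<dots> = \<Psi> (\<Sum>j<Suc t. f j * omit_det t y j ^ p) + \<Psi> (of_nat p * h)"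
    unfolding fh \<Psi>.hom_add ..
  finally have "\<pi> ?r = (\<Sum>j<Suc t. \<pi> (\<Psi> (f j * omit_det t y j ^ p))) + \<pi> (\<Psi> (of_nat p * h))"
    by (simp only: \<pi>_add \<pi>_sum)
  moreover have "\<pi> ?r = ?r"
    by (intro \<pi>_id subalgebra_mult[OF sub] E_power E_mem) (use t in auto)
  \<comment> \<open>Powers of minors lie in the subalgebra and are pulled out by linearity; only the
    multipliers are changed by the splitting.\<close>
  moreover have "\<pi> (\<Psi> (f j * omit_det t y j ^ p)) = E j ^ p * \<pi> (\<Psi> (f j))" if "j < Suc t" for j
    using \<pi>_mult[OF E_power[of j p], of "f j"] that E[of j]
    by (simp add: \<Psi>.hom_mult \<Psi>.hom_power mult.commute)
  moreover have "\<pi> (\<Psi> (of_nat p * h)) = of_nat p * \<pi> (\<Psi> h)"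
    using \<pi>_mult[OF p_mem] by (simp add: \<Psi>.hom_mult \<Psi>.hom_of_nat)
  ultimately have "?r = (\<Sum>j<Suc t. E j ^ p * \<pi> (\<Psi> (f j))) + of_nat p * \<pi> (\<Psi> h)"
    by simp
  then have "specialize t ?r
      = specialize t ((\<Sum>j<Suc t. E j ^ p * \<pi> (\<Psi> (f j))) + of_nat p * \<pi> (\<Psi> h))"
    by (rule arg_cong)
  then have "specialize t (E 0) ^ (p - 1) * specialize t (E 1) ^ (p - 1) * specialize t (E 2)
      = (\<Sum>j<Suc t. specialize t (E j) ^ p * specialize t (\<pi> (\<Psi> (f j))))
        + of_nat p * specialize t (\<pi> (\<Psi> h))"
    by (simp only: \<sigma>.hom_mult \<sigma>.hom_power \<sigma>.hom_add \<sigma>.hom_sum \<sigma>.hom_of_nat)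
  then have "omit_det t (special t) 0 ^ (p - 1) * omit_det t (special t) 1 ^ (p - 1) * omit_det t (special t) 2
      = (\<Sum>j<Suc t. omit_det t (special t) j ^ p * specialize t (\<pi> (\<Psi> (f j))))
        + of_nat p * specialize t (\<pi> (\<Psi> h))"
    using t \<sigma>E[of 0] \<sigma>E[of 1] \<sigma>E[of 2] \<sigma>E by simp
  then show False
    by (intro omit_det_not_in_power_ideal[OF p t2 _ _ refl, of "\<lambda>j. specialize t (\<pi> (\<Psi> (f j)))"])
      (use specialize_mem_spec_ring[OF p t2] \<Psi>(2) \<Delta> in auto)
qed

theorem mainTheorem5:
  fixes t n :: nat
    and \<Delta> :: "(nat \<times> nat, rat) mpoly set"
    and \<pi> :: "(nat \<times> nat, rat) mpoly \<Rightarrow> (nat \<times> nat, rat) mpoly"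
  assumes "1 < t" and "t < n"
    and "\<Delta> = minors t (generic_matrix t n)"
    and "is_linear_splitting (generated_algebra UNIV \<Delta>) (polynomials (matrix_vars t n)) \<pi>"
  shows "\<forall>p::nat. prime p \<longrightarrow>
    (\<exists>\<mu> \<in> monomials (matrix_vars t n).
       (\<forall>F \<in> polynomials \<Delta>. evaluate F = \<pi> \<mu> \<longrightarrow>
          (\<exists>m \<in> Poly_Mapping.keys F. int p dvd denominator (Poly_Mapping.lookup F m))) \<and>
       \<pi> \<mu> \<notin> generated_algebra (localized_ints p) \<Delta>)"
proof (intro allI impI)
  fix p :: nat
  assume p: "prime p"
  obtain \<mu> where \<mu>: "\<mu> \<in> monomials (matrix_vars t n)"
    "\<pi> \<mu> \<notin> generated_algebra (localized_ints p) \<Delta>"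
    using no_integral_splitting[OF p assms] by blast
  have "\<exists>m \<in> Poly_Mapping.keys F. int p dvd denominator (Poly_Mapping.lookup F m)"
    if F: "F \<in> polynomials \<Delta>" "evaluate F = \<pi> \<mu>" for F
  proof (rule ccontr)
    assume "\<not> ?thesis"
    \<comment> \<open>If p divided no denominator, the expression itself would place its value in
      the subalgebra over the localized integers.\<close>
    then have "Poly_Mapping.lookup F m \<in> localized_ints p" if "m \<in> Poly_Mapping.keys F" for m
      using that by (intro localized_intsI) blast
    then have "evaluate F \<in> generated_algebra (localized_ints p) \<Delta>"
      using of_int_mem_localized_ints[OF p, of 0] of_int_mem_localized_ints[OF p, of 1]
      by (intro evaluate_mem_generated_algebra[OF F(1)]) auto
    then show False using \<mu>(2) F(2) by simp
  qed
  then show "\<exists>\<mu> \<in> monomials (matrix_vars t n).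
       (\<forall>F \<in> polynomials \<Delta>. evaluate F = \<pi> \<mu> \<longrightarrow>
          (\<exists>m \<in> Poly_Mapping.keys F. int p dvd denominator (Poly_Mapping.lookup F m))) \<and>
       \<pi> \<mu> \<notin> generated_algebra (localized_ints p) \<Delta>"
    using \<mu> by blast
qed

end
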